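(* For all $\epsilon>0$, $D\geq 4$ and $0<\alpha<1/D^2$, there exists a $C>0$ such that the following holds for all $n$ sufficiently large (in terms of $\epsilon,D,\alpha$). Suppose $G$ is an $n$-vertex connected $(\alpha,D)$-spreader graph. Then \[\bar t_{\mathrm{mix}}(G,\epsilon)\leq C\log n.\]
   Context: Graphs are finite and simple. For a graph $G$ and $S\subseteq V(G)$, $e_G(S)$ is the number of edges of $G$ with both endpoints in $S$, $\partial_G(S)$ is the set of edges with exactly one endpoint in $S$, and $S$ is called $G$-connected if the induced subgraph $G[S]$ is connected. $\log$ is the natural logarithm. For $\alpha>0$, a set $S\subseteq V(G)$ is $\alpha$-thin in $G$ if $|\partial_G(S)|<\alpha|S|$. For $D>0$, a set $S\subseteq V(G)$ is $D$-loaded in $G$ if $e_G(S)>D|S|$. An $n$-vertex graph $G$ is an $(\alpha,D)$-spreader graph if the following three properties hold: (S1) for all integers $k$ with $(\log n)^{1/5}\le k\le(1-1/D^2)n$, the number of $G$-connected $\alpha$-thin sets $S\subseteq V(G)$ with $|S|=k$ is less than $n\mathrm{e}^{-\sqrt{k}}$; (S2) for all integers $k$ with $(\log n)^{1/5}\le k\le(1-1/D^2)n$, the number of $G$-connected $\alpha^{-1}$-loaded sets $S\subseteq V(G)$ with $|S|=k$ is less than $n\mathrm{e}^{-\sqrt{k}}$; (S3) no set $S\subseteq V(G)$ with $|S|\geq\alpha n$ is $D$-loaded in $G$. The lazy random walk on a connected graph $G$ has transition matrix $P_G$ given by $P_G(i,i)=1/2$ and, for $i\neq j$, $P_G(i,j)=1/(2\deg_G(i))$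 if $ij\in E(G)$ and $P_G(i,j)=0$ otherwise. Its stationary distribution is $\pi_G(u)=\deg_G(u)/(2e(G))$, where $e(G)=|E(G)|$. For $u\in V(G)$, $\mu_0^u$ is the point mass at $u$. Total variation distance is $d_{\mathrm{TV}}(\mu,\nu)=\frac12\sum_{v}|\mu(v)-\nu(v)|$. The average $\epsilon$-mixing time of a connected graph $G$ is \[\bar t_{\mathrm{mix}}(G,\epsilon)=\min\Big\{t\in\mathbb{N}_0:\frac{1}{|V(G)|}\sum_{u\in V(G)}d_{\mathrm{TV}}(\mu_0^uP_G^t,\pi_G)\leq\epsilon\Big\}.\] *)

theory Defs
  imports Complex_Main "Graph_Theory.Digraph_Component"
begin

text \<open>
  Finite simple graphs are the \<^locale>\<open>pair_graph\<close> structures of the Graph Theory library: finite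
  vertex set, finite, symmetric and loop-free arc relation without parallel arcs. The arcs
  \<open>(u, v)\<close> and \<open>(v, u)\<close> together represent one undirected edge, so edges are counted as
  two-element sets.
\<close>

definition graph_edges :: "'a pair_pre_digraph \<Rightarrow> 'a set set" where
  "graph_edges G = {{u, v} | u v. (u, v) \<in> parcs G}"

definition edges_within :: "'a pair_pre_digraph \<Rightarrow> 'a set \<Rightarrow> nat" where
  "edges_within G S = card {e \<in> graph_edges G. e \<subseteq> S}"

definition edge_boundary :: "'a pair_pre_digraph \<Rightarrow> 'a set \<Rightarrow> 'a set set" where
  "edge_boundary G S = {e \<in> graph_edges G. card (e \<inter> S) = 1}"

text \<open>
  The qualified name avoids the topological \<^const>\<open>Topological_Spaces.connected\<close>. The library
  notion requires a nonempty vertex set.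
\<close>

definition graph_connected :: "'a pair_pre_digraph \<Rightarrow> bool" where
  "graph_connected G \<longleftrightarrow> Digraph_Component.connected (with_proj G)"

definition connected_in :: "'a pair_pre_digraph \<Rightarrow> 'a set \<Rightarrow> bool" where
  "connected_in G S \<longleftrightarrow> Digraph_Component.connected (with_proj G \<restriction> S)"

definition thin :: "real \<Rightarrow> 'a pair_pre_digraph \<Rightarrow> 'a set \<Rightarrow> bool" where
  "thin \<alpha> G S \<longleftrightarrow> real (card (edge_boundary G S)) < \<alpha> * real (card S)"

definition loaded :: "real \<Rightarrow> 'a pair_pre_digraph \<Rightarrow> 'a set \<Rightarrow> bool" where
  "loaded D G S \<longleftrightarrow> real (edges_within G S) > D * real (card S)"

definition spreader :: "real \<Rightarrow> real \<Rightarrow> 'a pair_pre_digraph \<Rightarrow> bool" where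
  "spreader \<alpha> D G \<longleftrightarrow>
    (let n = real (card (pverts G)) in
      (\<forall>k::nat. ln n powr (1/5) \<le> real k \<and> real k \<le> (1 - 1 / D\<^sup>2) * n \<longrightarrow>
        real (card {S. S \<subseteq> pverts G \<and> card S = k \<and> connected_in G S \<and> thin \<alpha> G S})
          < n * exp (- sqrt (real k))) \<and>
      (\<forall>k::nat. ln n powr (1/5) \<le> real k \<and> real k \<le> (1 - 1 / D\<^sup>2) * n \<longrightarrow>
        real (card {S. S \<subseteq> pverts G \<and> card S = k \<and> connected_in G S \<and> loaded (1 / \<alpha>) G S})
          < n * exp (- sqrt (real k))) \<and>
      \<not> (\<exists>S \<subseteq> pverts G. real (card S) \<ge> \<alpha> * n \<and> loaded D G S))"

text \<open>As the arc relation is symmetric and loop-free, the out-degree is the degree.\<close>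

definition graph_deg :: "'a pair_pre_digraph \<Rightarrow> 'a \<Rightarrow> nat" where
  "graph_deg G v = out_degree (with_proj G) v"

text \<open>
  Vectors and matrices indexed by the vertices are functions on the vertex type; only their
  entries at vertices of the graph matter.
\<close>

definition lazy_walk :: "'a pair_pre_digraph \<Rightarrow> 'a \<Rightarrow> 'a \<Rightarrow> real" where
  "lazy_walk G i j =
    (if i = j then 1 / 2
     else if (i, j) \<in> parcs G then 1 / (2 * real (graph_deg G i))
     else 0)"

primrec lazy_walk_pow :: "'a pair_pre_digraph \<Rightarrow> nat \<Rightarrow> 'a \<Rightarrow> 'a \<Rightarrow> real" where
  "lazy_walk_pow G 0 = (\<lambda>i j. if i = j then 1 else 0)"
| "lazy_walk_pow G (Suc t) =
    (\<lambda>i j. \<Sum>k\<in>pverts G. lazy_walk_pow G t i k * lazy_walk G k j)"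

definition point_mass :: "'a \<Rightarrow> 'a \<Rightarrow> real" where
  "point_mass u v = (if v = u then 1 else 0)"

definition walk_distr :: "'a pair_pre_digraph \<Rightarrow> ('a \<Rightarrow> real) \<Rightarrow> nat \<Rightarrow> 'a \<Rightarrow> real" where
  "walk_distr G \<mu> t v = (\<Sum>u\<in>pverts G. \<mu> u * lazy_walk_pow G t u v)"

definition stationary :: "'a pair_pre_digraph \<Rightarrow> 'a \<Rightarrow> real" where
  "stationary G u = real (graph_deg G u) / (2 * real (card (graph_edges G)))"

definition tv_dist :: "'a set \<Rightarrow> ('a \<Rightarrow> real) \<Rightarrow> ('a \<Rightarrow> real) \<Rightarrow> real" where
  "tv_dist V \<mu> \<nu> = 1 / 2 * (\<Sum>v\<in>V. \<bar>\<mu> v - \<nu> v\<bar>)"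

definition avg_mixing_time :: "'a pair_pre_digraph \<Rightarrow> real \<Rightarrow> nat" where
  "avg_mixing_time G \<epsilon> =
    (LEAST t. 1 / real (card (pverts G)) *
       (\<Sum>u\<in>pverts G. tv_dist (pverts G) (walk_distr G (point_mass u) t) (stationary G)) \<le> \<epsilon>)"

end

theory Submission
  imports Defs "HOL-Analysis.Convex" "HOL-Analysis.Summation_Tests"
    "HOL-Real_Asymp.Real_Asymp"
begin

text \<open>
  Call a connected set of intermediate size a bottleneck if its edge boundary is small compared to its
  volume (the sum of its degrees). By (S1) and (S2) bottlenecks are so rare that their union has
  volume \<open>o(n)\<close>, so it suffices to treat starting vertices \<open>u\<close> outside of all bottlenecks.

  Let \<open>A\<close> be a set with at least two fifths of the total volume, and let \<open>g\<close> be the expected number of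
  visits, divided by the degree, of the walk from \<open>u\<close> killed on \<open>A\<close>. By the maximum principle every
  superlevel set of \<open>g\<close> is connected and contains \<open>u\<close>, hence is not a bottleneck. The current leaving a
  superlevel set is bounded, so the volume of the superlevel set grows by a constant factor while \<open>g\<close>
  decreases by a constant over the volume. As connected sets of size below \<open>(ln n) powr (1/5)\<close> have
  at least one boundary edge, their contribution is also only \<open>O(ln n)\<close>. Summing over all levels
  shows that the walk from \<open>u\<close> hits \<open>A\<close> in expected time \<open>O(ln n)\<close>. For very large superlevel sets, (S3)
  applied to the complement bounds the boundary from below.

  For a function \<open>f\<close> with values in \<open>[0, 1]\<close>, positivity of the lazy walk makes \<open>P ^^ t\<close> \<open>f\<close> vary little
  in \<open>L\<^sup>2\<close> on time windows \<open>[s, s + W]\<close> with \<open>W\<close> small compared to \<open>s\<close>. The walk from \<open>u\<close> hits within time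
  \<open>W = O(ln n)\<close> both the set where \<open>P ^^ s\<close> \<open>f\<close> is at least its median \<open>m\<close> and the set where it is at most
  \<open>m\<close>, so \<open>(P ^^ (s + W))\<close> \<open>f\<close> is close to \<open>m\<close> at \<open>u\<close>. Averaging over \<open>u\<close> identifies \<open>m\<close> with the
  stationary mean of \<open>f\<close>. No bound on the spectral gap is needed.
\<close>

section \<open>The lazy walk operator\<close>

text \<open>Connectivity enters as \<open>E_out\<close>, the form in which the maximum principle and
  the lower bounds on cuts use it. Together with two vertices it makes all degrees positive, so
  every division by \<open>deg\<close> on \<open>V\<close> is genuine.\<close>

locale finite_sym_graph =
  fixes V :: "'a set" and E :: "('a \<times> 'a) set"
  assumes finite_V: "finite V"
    and E_subset: "E \<subseteq> V \<times> V"
    and E_sym: "(x, y) \<in> E \<Longrightarrow> (y, x) \<in> E"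
    and E_out: "S \<subseteq> V \<Longrightarrow> S \<noteq> {} \<Longrightarrow> S \<noteq> V \<Longrightarrow> \<exists>x\<in>S. \<exists>y\<in>V - S. (x, y) \<in> E"
    and V_nontrivial: "2 \<le> card V"
begin

definition deg :: "'a \<Rightarrow> real" where "deg x = real (card (E `` {x}))"
definition vol :: "'a set \<Rightarrow> real" where "vol S = (\<Sum>x\<in>S. deg x)"

text \<open>\<open>inner\<close> counts arcs, that is, every edge twice, whereas \<open>cut\<close> counts every edge once.\<close>

definition inner :: "'a set \<Rightarrow> real" where "inner S = real (card (E \<inter> S \<times> S))"
definition cut :: "'a set \<Rightarrow> real" where "cut S = real (card (E \<inter> S \<times> (- S)))"

text \<open>The transition matrix acting on functions: \<open>P f x\<close> is the expectation of
  \<open>f\<close> after one lazy step from \<open>x\<close>.\<close>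

definition P :: "('a \<Rightarrow> real) \<Rightarrow> 'a \<Rightarrow> real" where
  "P f x = (f x + (\<Sum>y\<in>E `` {x}. f y) / deg x) / 2"

text \<open>The weights form an unnormalised stationary measure, for which the walk is reversible
  and \<open>P\<close> self-adjoint.\<close>

definition ip :: "('a \<Rightarrow> real) \<Rightarrow> ('a \<Rightarrow> real) \<Rightarrow> real" where
  "ip f g = (\<Sum>x\<in>V. deg x * f x * g x)"

lemma finite_E: "finite E"
  using E_subset finite_V by (meson finite_SigmaI finite_subset)

lemma E_in_V: "(x, y) \<in> E \<Longrightarrow> x \<in> V" "(x, y) \<in> E \<Longrightarrow> y \<in> V"
  using E_subset by auto

lemma finite_nbrs: "finite (E `` {x})"
  using finite_E by (metis finite_Image finite.emptyI finite.insertI)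

lemma deg_ge_1: assumes "x \<in> V" shows "1 \<le> deg x"
proof -
  have "{x} \<noteq> V" using V_nontrivial by auto
  then obtain y where "(x, y) \<in> E" using E_out[of "{x}"] assms by auto
  then have "E `` {x} \<noteq> {}" by auto
  then have "card (E `` {x}) > 0" using finite_nbrs by (simp add: card_gt_0_iff)
  then show ?thesis unfolding deg_def by simp
qed

lemma deg_pos: "x \<in> V \<Longrightarrow> 0 < deg x"
  using deg_ge_1 by fastforce

lemma deg_nonneg: "0 \<le> deg x"
  by (simp add: deg_def)

lemma sum_arcs: "S \<subseteq> V \<Longrightarrow> (\<Sum>x\<in>S. \<Sum>y\<in>E `` {x}. F x y) = (\<Sum>(x, y)\<in>E \<inter> S \<times> UNIV. (F x y :: real))"
proof -
  assume S: "S \<subseteq> V"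
  have "E \<inter> S \<times> UNIV = Sigma S (\<lambda>x. E `` {x})" by auto
  then show ?thesis using S finite_V finite_nbrs
    by (simp add: sum.Sigma finite_subset)
qed

lemma sum_arcs_V: "(\<Sum>x\<in>V. \<Sum>y\<in>E `` {x}. F x y) = (\<Sum>(x, y)\<in>E. (F x y :: real))"
proof -
  have "E \<inter> V \<times> UNIV = E" using E_subset by auto
  then show ?thesis using sum_arcs[of V F] by simp
qed

lemma sum_arcs_swap:
  assumes "\<And>x y. (x, y) \<in> A \<Longrightarrow> (y, x) \<in> A"
  shows "(\<Sum>(x, y)\<in>A. F x y) = (\<Sum>(x, y)\<in>A. (F y x :: real))"
proof (rule sum.reindex_bij_witness[where i=prod.swap and j=prod.swap])
qed (use assms in auto)

section \<open>Reversibility and positivity of the lazy walk\<close>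

lemma ip_eq_arcs: "ip f g = (\<Sum>(x, y)\<in>E. f x * g x)"
proof -
  have "ip f g = (\<Sum>x\<in>V. \<Sum>y\<in>E `` {x}. f x * g x)"
    by (simp add: ip_def deg_def mult.assoc)
  then show ?thesis by (simp only: sum_arcs_V)
qed

lemma ip_eq_arcs': "ip f g = (\<Sum>(x, y)\<in>E. f y * g y)"
  unfolding ip_eq_arcs by (rule sum_arcs_swap) (rule E_sym)

lemma deg_P: "x \<in> V \<Longrightarrow> deg x * P f x = (deg x * f x + (\<Sum>y\<in>E `` {x}. f y)) / 2"
  using deg_pos[of x] by (simp add: P_def field_simps)

lemma ip_P: "ip f (P g) = (ip f g + (\<Sum>(x, y)\<in>E. f x * g y)) / 2"
proof -
  have "ip f (P g) = (\<Sum>x\<in>V. f x * (deg x * P g x))"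
    by (simp add: ip_def algebra_simps)
  also have "\<dots> = (\<Sum>x\<in>V. f x * ((deg x * g x + (\<Sum>y\<in>E `` {x}. g y)) / 2))"
    by (intro sum.cong) (auto simp: deg_P)
  also have "\<dots> = (\<Sum>x\<in>V. deg x * f x * g x) / 2 + (\<Sum>x\<in>V. \<Sum>y\<in>E `` {x}. f x * g y) / 2"
    by (simp add: sum_divide_distrib[symmetric] sum.distrib[symmetric] sum_distrib_left[symmetric] algebra_simps)
  finally show ?thesis by (simp add: ip_def sum_arcs_V add_divide_distrib)
qed

lemma ip_commute: "ip f g = ip g f"
  by (simp add: ip_def algebra_simps)

lemma ip_P_commute: "ip f (P g) = ip (P f) g"
proof -
  have "(\<Sum>(x, y)\<in>E. f x * g y) = (\<Sum>(x, y)\<in>E. f y * g x)"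
    by (rule sum_arcs_swap) (rule E_sym)
  then have "ip f (P g) = ip g (P f)"
    by (simp add: ip_P ip_commute[of f g] mult.commute)
  then show ?thesis by (simp add: ip_commute)
qed

lemma ip_self_nonneg: "0 \<le> ip f f"
  unfolding ip_def by (intro sum_nonneg) (simp add: deg_nonneg mult.assoc)

text \<open>Laziness makes \<open>ip f (P f)\<close> a quarter of the sum of the squares of
  \<open>f x + f y\<close> over all arcs.\<close>

lemma ip_P_nonneg: "0 \<le> ip f (P f)"
proof -
  define X where "X = (\<Sum>(x, y)\<in>E. f x * f y)"
  have "(\<Sum>(x, y)\<in>E. (f x + f y)\<^sup>2) = (\<Sum>(x, y)\<in>E. f x * f x) + (\<Sum>(x, y)\<in>E. f y * f y) + 2 * X"
    by (simp add: X_def sum_distrib_left sum.distrib[symmetric] case_prod_unfold power2_eq_square algebra_simps)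
  then have "(\<Sum>(x, y)\<in>E. (f x + f y)\<^sup>2) = ip f f + ip f f + 2 * X"
    unfolding ip_eq_arcs[symmetric] ip_eq_arcs'[symmetric] .
  moreover have "ip f (P f) = (ip f f + X) / 2" unfolding X_def by (rule ip_P)
  moreover have "0 \<le> (\<Sum>(x, y)\<in>E. (f x + f y)\<^sup>2)" by (simp add: sum_nonneg case_prod_unfold)
  ultimately show ?thesis by simp
qed

text \<open>The difference is the Dirichlet form, a quarter of the sum of the squares of
  \<open>f x - f y\<close> over all arcs.\<close>

lemma ip_P_le: "ip f (P f) \<le> ip f f"
proof -
  define X where "X = (\<Sum>(x, y)\<in>E. f x * f y)"
  have "(\<Sum>(x, y)\<in>E. (f x - f y)\<^sup>2) = (\<Sum>(x, y)\<in>E. f x * f x) + (\<Sum>(x, y)\<in>E. f y * f y) - 2 * X"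
    by (simp add: X_def sum_distrib_left sum.distrib[symmetric] sum_subtractf[symmetric] case_prod_unfold power2_eq_square algebra_simps)
  then have "(\<Sum>(x, y)\<in>E. (f x - f y)\<^sup>2) = ip f f + ip f f - 2 * X"
    unfolding ip_eq_arcs[symmetric] ip_eq_arcs'[symmetric] .
  moreover have "ip f (P f) = (ip f f + X) / 2" unfolding X_def by (rule ip_P)
  moreover have "0 \<le> (\<Sum>(x, y)\<in>E. (f x - f y)\<^sup>2)" by (simp add: sum_nonneg case_prod_unfold)
  ultimately show ?thesis by simp
qed

lemma P_const: "x \<in> V \<Longrightarrow> P (\<lambda>_. c) x = c"
  using deg_pos[of x] by (simp add: P_def deg_def)

section \<open>Monotonicity, linearity and iterates of \<open>P\<close>\<close>

lemma P_mono: "(\<And>y. y \<in> V \<Longrightarrow> f y \<le> g y) \<Longrightarrow> x \<in> V \<Longrightarrow> P f x \<le> P g x"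
  unfolding P_def using E_in_V
  by (intro divide_right_mono add_mono sum_mono) (auto simp: deg_nonneg)

lemma P_cong: "(\<And>y. y \<in> V \<Longrightarrow> f y = g y) \<Longrightarrow> x \<in> V \<Longrightarrow> P f x = P g x"
  by (intro order_antisym P_mono) auto

lemma P_diff: "P (\<lambda>x. f x - g x) = (\<lambda>x. P f x - P g x)"
  by (auto simp: P_def fun_eq_iff sum_subtractf diff_divide_distrib add_divide_distrib)

lemma P_sum: "P (\<lambda>x. \<Sum>i\<in>I. f i x) = (\<lambda>x. \<Sum>i\<in>I. P (f i) x)"
proof
  fix x
  have "(\<Sum>y\<in>E `` {x}. \<Sum>i\<in>I. f i y) = (\<Sum>i\<in>I. \<Sum>y\<in>E `` {x}. f i y)" by (rule sum.swap)
  then show "P (\<lambda>x. \<Sum>i\<in>I. f i x) x = (\<Sum>i\<in>I. P (f i) x)"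
    unfolding P_def by (simp only: sum_divide_distrib[symmetric] sum.distrib)
qed

lemma P_scale: "P (\<lambda>x. c * f x) = (\<lambda>x. c * P f x)"
  by (auto simp: P_def fun_eq_iff sum_distrib_left[symmetric] distrib_left)

lemma Pn_diff: "(P ^^ n) (\<lambda>x. f x - g x) = (\<lambda>x. (P ^^ n) f x - (P ^^ n) g x)"
  by (induction n) (auto simp: P_diff)

lemma Pn_mono: "(\<And>y. y \<in> V \<Longrightarrow> f y \<le> g y) \<Longrightarrow> x \<in> V \<Longrightarrow> (P ^^ n) f x \<le> (P ^^ n) g x"
  by (induction n arbitrary: x) (auto intro: P_mono)

lemma Pn_const: "x \<in> V \<Longrightarrow> (P ^^ n) (\<lambda>_. c) x = c"
proof (induction n arbitrary: x)
  case (Suc n)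
  then show ?case using P_cong[of "(P ^^ n) (\<lambda>_. c)" "\<lambda>_. c" x] by (simp add: P_const)
qed auto

lemma ip_Pn_commute: "ip f ((P ^^ n) g) = ip ((P ^^ n) f) g"
proof (induction n arbitrary: f)
  case (Suc n)
  have "ip f ((P ^^ Suc n) g) = ip (P f) ((P ^^ n) g)" by (simp add: ip_P_commute)
  also have "\<dots> = ip ((P ^^ Suc n) f) g" unfolding Suc.IH funpow_Suc_right by simp
  finally show ?case .
qed simp

lemma ip_diff_left: "ip (\<lambda>x. f x - h x) g = ip f g - ip h g"
  by (simp add: ip_def sum_subtractf[symmetric] algebra_simps)

lemma ip_diff_right: "ip g (\<lambda>x. f x - h x) = ip g f - ip g h"
  by (simp add: ip_def sum_subtractf[symmetric] algebra_simps)

text \<open>The autocorrelation \<open>a\<close> is nonnegative and convex because both \<open>P\<close> (by laziness) and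
  \<open>1 - P\<close> are positive semidefinite, so its increments are at most of order \<open>1 / s\<close>.\<close>

lemma sum_increments_le:
  "(2 * real s + 1) * (\<Sum>j<W. ip ((P ^^ (s + j)) (\<lambda>x. f x - P f x)) ((P ^^ (s + j)) (\<lambda>x. f x - P f x))) \<le> ip f f"
proof -
  \<comment> \<open>By self-adjointness \<open>ip\<close> of two iterates of \<open>f\<close>
    depends only on the total exponent. Hence the squared norms to be summed are the second
    differences \<open>c\<close> of \<open>a\<close> at even times.\<close>
  define a where "a t = ip f ((P ^^ t) f)" for t
  define b where "b t = a t - a (Suc t)" for t
  define c where "c t = b t - b (Suc t)" for t
  let ?d = "\<lambda>x. f x - P f x"
  have ipa: "ip ((P ^^ i) f) ((P ^^ j) f) = a (i + j)" for i j
    unfolding a_def using ip_Pn_commute[of f i "(P ^^ j) f"] by (simp add: funpow_add)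
  have Pd: "(P ^^ i) ?d = (\<lambda>x. (P ^^ i) f x - (P ^^ Suc i) f x)" for i
    unfolding funpow_Suc_right comp_apply by (rule Pn_diff)
  have ipa': "ip ((P ^^ i) f) ((P ^^ j) f) = a k" if "i + j = k" for i j k
    using ipa[of i j] that by simp
  have c_even: "ip ((P ^^ i) ?d) ((P ^^ i) ?d) = c (2 * i)" for i
    unfolding Pd ip_diff_left ip_diff_right c_def b_def
    using ipa'[of i i "2 * i"] ipa'[of "Suc i" i "Suc (2 * i)"] ipa'[of i "Suc i" "Suc (2 * i)"]
      ipa'[of "Suc i" "Suc i" "Suc (Suc (2 * i))"] by linarith
  have c_odd: "ip ((P ^^ i) ?d) (P ((P ^^ i) ?d)) = c (Suc (2 * i))" for i
  proof -
    have "P ((P ^^ i) ?d) = (\<lambda>x. (P ^^ Suc i) f x - (P ^^ Suc (Suc i)) f x)"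
      using Pd[of "Suc i"] by simp
    then show ?thesis
      unfolding Pd ip_diff_left ip_diff_right c_def b_def
      using ipa'[of i "Suc i" "Suc (2 * i)"] ipa'[of "Suc i" "Suc i" "Suc (Suc (2 * i))"]
        ipa'[of i "Suc (Suc i)" "Suc (Suc (2 * i))"]
        ipa'[of "Suc i" "Suc (Suc i)" "Suc (Suc (Suc (2 * i)))"]
      by (simp only: ip_diff_left ip_diff_right)
  qed
  have c_nonneg: "0 \<le> c t" for t
  proof (cases "even t")
    case True then show ?thesis using c_even ip_self_nonneg by (metis evenE)
  next
    case False then show ?thesis using c_odd ip_P_nonneg by (metis oddE Suc_eq_plus1)
  qed
  have b_even: "0 \<le> b (2 * i)" for i
  proof -
    have "ip ((P ^^ i) f) (P ((P ^^ i) f)) = a (Suc (2 * i))"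
      using ipa'[of i "Suc i" "Suc (2 * i)"] by simp
    then show ?thesis
      using ip_P_le[of "(P ^^ i) f"] ipa'[of i i "2 * i"] unfolding b_def by linarith
  qed
  have b_dec: "b (Suc t) \<le> b t" for t using c_nonneg[of t] by (simp add: c_def)
  have b_anti: "i \<le> j \<Longrightarrow> b j \<le> b i" for i j by (rule lift_Suc_antimono_le[of b]) (use b_dec in auto)
  \<comment> \<open>Inserting the nonnegative odd terms of \<open>c\<close> makes the sum
    telescope.\<close>
  have "(\<Sum>j<W. c (2 * (s + j))) \<le> b (2 * s) - b (2 * (s + W))"
  proof (induction W)
    case (Suc W)
    then show ?case using c_nonneg[of "Suc (2 * (s + W))"] by (simp add: c_def)
  qed simp
  then have 1: "(\<Sum>j<W. c (2 * (s + j))) \<le> b (2 * s)" using b_even[of "s + W"] by simp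
  \<comment> \<open>As \<open>b\<close> is nonincreasing, its first \<open>2 * s + 1\<close> values
    are all at least \<open>b (2 * s)\<close>, and they telescope.\<close>
  have "(2 * real s + 1) * b (2 * s) = (\<Sum>i<2 * s + 1. b (2 * s))" by simp
  also have "\<dots> \<le> (\<Sum>i<2 * s + 1. b i)" by (intro sum_mono b_anti) auto
  also have "\<dots> = a 0 - a (2 * s + 1)" unfolding b_def by (rule sum_lessThan_telescope')
  also have "\<dots> \<le> a 0"
    using ip_P_nonneg[of "(P ^^ s) f"] ipa'[of s "Suc s" "2 * s + 1"] by simp
  finally have 2: "(2 * real s + 1) * b (2 * s) \<le> ip f f" by (simp add: a_def)
  have "(2 * real s + 1) * (\<Sum>j<W. c (2 * (s + j))) \<le> (2 * real s + 1) * b (2 * s)"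
    using 1 by (intro mult_left_mono) auto
  with 2 show ?thesis unfolding c_even by linarith
qed

text \<open>By Cauchy-Schwarz, a change above \<delta> within \<open>W\<close> steps forces the
  squared one-step increments at that point to sum to at least \<open>\<delta>\<^sup>2 / W\<close>.
  \<open>sum_increments_le\<close> bounds their total over all points.\<close>

lemma slow_variation:
  assumes "0 < \<delta>" and "\<And>x. x \<in> V \<Longrightarrow> \<bar>f x\<bar> \<le> 1"
  shows "vol {x\<in>V. \<exists>j\<le>W. \<delta> < \<bar>(P ^^ (s + j)) f x - (P ^^ s) f x\<bar>} * ((2 * real s + 1) * \<delta>\<^sup>2) \<le> real W * vol V"
proof -
  define B where "B = {x\<in>V. \<exists>j\<le>W. \<delta> < \<bar>(P ^^ (s + j)) f x - (P ^^ s) f x\<bar>}"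
  define d where "d i x = (P ^^ (s + i)) (\<lambda>x. f x - P f x) x" for i x
  have d: "d i x = (P ^^ (s + i)) f x - (P ^^ (s + Suc i)) f x" for i x
    unfolding d_def Pn_diff add_Suc_right funpow_Suc_right comp_apply ..
  have large: "\<delta>\<^sup>2 \<le> real W * (\<Sum>i<W. (d i x)\<^sup>2)" if "x \<in> B" for x
  proof -
    from that obtain j where j: "j \<le> W" "\<delta> < \<bar>(P ^^ (s + j)) f x - (P ^^ s) f x\<bar>"
      unfolding B_def by blast
    have "(\<Sum>i<j. d i x) = (P ^^ s) f x - (P ^^ (s + j)) f x"
      unfolding d using sum_lessThan_telescope'[of "\<lambda>i. (P ^^ (s + i)) f x" j] by simp
    then have "\<delta>\<^sup>2 \<le> (\<Sum>i<j. d i x)\<^sup>2"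
      using j(2) assms(1) by (intro abs_le_square_iff[THEN iffD1]) auto
    also have "\<dots> \<le> (\<Sum>i<j. (d i x)\<^sup>2) * real j"
      using sum_squared_le_sum_of_squares[of "\<lambda>i. d i x" "{..<j}"] by (cases "j = 0") auto
    also have "\<dots> \<le> (\<Sum>i<W. (d i x)\<^sup>2) * real W"
      using j(1) by (intro mult_mono sum_mono2 sum_nonneg) auto
    finally show ?thesis by (simp add: mult.commute)
  qed
  have "vol B * \<delta>\<^sup>2 = (\<Sum>x\<in>B. deg x * \<delta>\<^sup>2)" by (simp add: vol_def sum_distrib_right)
  also have "\<dots> \<le> (\<Sum>x\<in>B. deg x * (real W * (\<Sum>i<W. (d i x)\<^sup>2)))"
    by (intro sum_mono mult_left_mono large deg_nonneg)
  also have "\<dots> \<le> (\<Sum>x\<in>V. deg x * (real W * (\<Sum>i<W. (d i x)\<^sup>2)))"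
    using finite_V by (intro sum_mono2 mult_nonneg_nonneg sum_nonneg) (auto simp: B_def deg_nonneg)
  also have "\<dots> = real W * (\<Sum>x\<in>V. \<Sum>i<W. deg x * d i x * d i x)"
    by (simp add: sum_distrib_left power2_eq_square algebra_simps)
  also have "\<dots> = real W * (\<Sum>i<W. ip (d i) (d i))"
    unfolding ip_def by (subst sum.swap) simp
  finally have "vol B * \<delta>\<^sup>2 * (2 * real s + 1) \<le> real W * (\<Sum>i<W. ip (d i) (d i)) * (2 * real s + 1)"
    by (intro mult_right_mono) auto
  also have "\<dots> \<le> real W * ip f f"
    using mult_left_mono[OF sum_increments_le[of s f W], of "real W"] by (simp add: d_def[abs_def] algebra_simps)
  also have "ip f f \<le> vol V"
    unfolding ip_def vol_def
  proof (intro sum_mono)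
    fix x assume "x \<in> V"
    then have "f x * f x \<le> 1" using assms(2)[of x] by (metis abs_ge_zero abs_mult_self_eq mult_le_one)
    then show "deg x * f x * f x \<le> deg x" using deg_nonneg[of x] by (metis mult.assoc mult_left_le)
  qed
  then have "real W * ip f f \<le> real W * vol V" by (intro mult_left_mono) auto
  finally show ?thesis by (simp add: B_def algebra_simps)
qed

section \<open>The killed walk and its Green function\<close>

definition killed :: "'a set \<Rightarrow> ('a \<Rightarrow> real) \<Rightarrow> 'a \<Rightarrow> real" where
  "killed A f v = (if v \<in> V - A then P f v else 0)"

text \<open>\<open>survival A t v\<close> is the probability that the walk from \<open>v\<close> avoids \<open>A\<close> at all times \<open>0, \<dots>, t\<close>.\<close>

definition survival :: "'a set \<Rightarrow> nat \<Rightarrow> 'a \<Rightarrow> real" where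
  "survival A t = (killed A ^^ t) (\<lambda>v. if v \<in> V - A then 1 else 0)"

lemma survival_Suc: "survival A (Suc t) = killed A (survival A t)"
  by (simp add: survival_def)

lemma survival_outside: "v \<notin> V - A \<Longrightarrow> survival A t v = 0"
  by (cases t) (auto simp: survival_def killed_def)

lemma survival_nonneg: "0 \<le> survival A t v"
proof (induction t arbitrary: v)
  case (Suc t)
  have "0 \<le> P (survival A t) v" if "v \<in> V"
    using P_mono[of "\<lambda>_. 0" "survival A t" v] Suc that by (simp add: P_const)
  then show ?case by (auto simp: survival_Suc killed_def)
qed (simp add: survival_def)

lemma survival_decreasing: "survival A (Suc t) v \<le> survival A t v"
proof (induction t arbitrary: v)
  case 0
  have "P (survival A 0) v \<le> 1" if "v \<in> V"
    using P_mono[of "survival A 0" "\<lambda>_. 1" v] that by (simp add: P_const survival_def)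
  then show ?case by (auto simp: survival_Suc killed_def) (auto simp: survival_def)
next
  case (Suc t)
  show ?case
  proof (cases "v \<in> V - A")
    case True
    then have "survival A (Suc k) v = P (survival A k) v" for k by (simp add: survival_Suc killed_def)
    then show ?thesis using P_mono[OF Suc, of v] True by simp
  next
    case False
    then have "survival A k v = 0" for k by (rule survival_outside)
    then show ?thesis by simp
  qed
qed

lemma survival_antimono: "s \<le> t \<Longrightarrow> survival A t v \<le> survival A s v"
  by (rule lift_Suc_antimono_le[of "\<lambda>t. survival A t v"]) (rule survival_decreasing)

lemma Pn_ge_hitting:
  assumes "\<And>j y. j \<le> W \<Longrightarrow> y \<in> A \<inter> V \<Longrightarrow> a \<le> (P ^^ (s + j)) f y"
    and "0 \<le> a" and "\<And>y. y \<in> V \<Longrightarrow> 0 \<le> f y" and "x \<in> V"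
  shows "a * (1 - survival A W x) \<le> (P ^^ (s + W)) f x"
  using assms(1,4)
proof (induction W arbitrary: x)
  case 0
  have "0 \<le> (P ^^ s) f x"
    using Pn_mono[of "\<lambda>_. 0" f x s] assms(3) 0 by (simp add: Pn_const)
  then show ?case using 0 by (cases "x \<in> A") (auto simp: survival_def)
next
  case (Suc W)
  show ?case
  proof (cases "x \<in> A")
    case True
    then show ?thesis using Suc.prems(1)[of "Suc W" x] Suc.prems(2) by (simp add: survival_outside)
  next
    case False
    have "P (\<lambda>y. a * (1 - survival A W y)) x = a * (P (\<lambda>_. 1) x - P (survival A W) x)"
      unfolding P_scale P_diff ..
    then have "a * (1 - survival A (Suc W) x) = P (\<lambda>y. a * (1 - survival A W y)) x"
      using False Suc.prems(2) by (simp add: survival_Suc killed_def P_const)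
    also have "\<dots> \<le> P ((P ^^ (s + W)) f) x"
      using Suc.prems by (intro P_mono Suc.IH) auto
    finally show ?thesis by simp
  qed
qed

text \<open>Killing only multiplies by an indicator, which is invisible when paired with a function
  vanishing on \<open>A\<close>; self-adjointness of \<open>P\<close> does the rest.\<close>

lemma ip_killed:
  assumes "\<And>v. v \<in> A \<Longrightarrow> f v = 0" and "\<And>v. v \<in> A \<Longrightarrow> h v = 0"
  shows "ip f (killed A h) = ip (killed A f) h"
proof -
  have "ip f (killed A h) = ip f (P h)"
    unfolding ip_def using assms(1) by (intro sum.cong) (auto simp: killed_def)
  also have "\<dots> = ip (P f) h" by (rule ip_P_commute)
  also have "\<dots> = ip (killed A f) h"
    unfolding ip_def using assms(2) by (intro sum.cong) (auto simp: killed_def)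
  finally show ?thesis .
qed

text \<open>The density of the point mass at \<open>u\<close> with respect to the degree measure, so
  that pairing with it under \<open>ip\<close> evaluates at \<open>u\<close>.\<close>

definition unit_mass :: "'a \<Rightarrow> 'a \<Rightarrow> real" where
  "unit_mass u v = (if v = u then 1 / deg u else 0)"

text \<open>By reversibility this is the expected number of visits to \<open>v\<close> up to time
  \<open>W\<close> of the walk from \<open>u\<close> killed on \<open>A\<close>, divided by
  \<open>deg v\<close>. Truncation at \<open>W\<close> keeps the sum finite.\<close>

definition green :: "'a set \<Rightarrow> 'a \<Rightarrow> nat \<Rightarrow> 'a \<Rightarrow> real" where
  "green A u W v = (\<Sum>t\<le>W. (killed A ^^ t) (unit_mass u) v)"

lemma killed_unit_mass_outside:
  assumes "u \<in> V - A" and "v \<notin> V - A"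
  shows "(killed A ^^ t) (unit_mass u) v = 0"
  using assms by (cases t) (auto simp: killed_def unit_mass_def)

lemma killed_unit_mass_nonneg: "0 \<le> (killed A ^^ t) (unit_mass u) v"
proof (induction t arbitrary: v)
  case 0
  then show ?case by (simp add: unit_mass_def deg_nonneg)
next
  case (Suc t)
  have "0 \<le> P ((killed A ^^ t) (unit_mass u)) v" if "v \<in> V"
    using P_mono[of "\<lambda>_. 0" "(killed A ^^ t) (unit_mass u)" v] Suc that by (simp add: P_const)
  then show ?case by (simp add: killed_def[of A "(killed A ^^ t) (unit_mass u)"])
qed

text \<open>The sum pairs the killed density at time \<open>t\<close> with the indicator of
  \<open>V - A\<close>. Self-adjointness moves all \<open>t\<close> steps onto the indicator, which
  becomes \<open>survival A t\<close>, evaluated at \<open>u\<close>.\<close>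

lemma sum_deg_killed:
  assumes "u \<in> V - A"
  shows "(\<Sum>v\<in>V. deg v * (killed A ^^ t) (unit_mass u) v) = survival A t u"
proof -
  have "ip ((killed A ^^ (i + t)) (unit_mass u)) (survival A j) = ip ((killed A ^^ i) (unit_mass u)) (survival A (j + t))" for i j
  proof (induction t arbitrary: i j)
    case (Suc t)
    have "ip ((killed A ^^ (i + Suc t)) (unit_mass u)) (survival A j)
        = ip ((killed A ^^ Suc i) (unit_mass u)) (survival A (j + t))"
      using Suc[of "Suc i" j] by simp
    also have "\<dots> = ip ((killed A ^^ i) (unit_mass u)) (survival A (j + Suc t))"
      using ip_killed[of A "(killed A ^^ i) (unit_mass u)" "survival A (j + t)"]
        killed_unit_mass_outside[OF assms] survival_outside
      by (simp add: survival_Suc)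
    finally show ?case .
  qed simp
  from this[of 0 0] have *: "ip ((killed A ^^ t) (unit_mass u)) (survival A 0) = ip (unit_mass u) (survival A t)"
    by simp
  have "(\<Sum>v\<in>V. deg v * (killed A ^^ t) (unit_mass u) v) = ip ((killed A ^^ t) (unit_mass u)) (survival A 0)"
    unfolding ip_def using killed_unit_mass_outside[OF assms]
    by (intro sum.cong) (auto simp: survival_def)
  also have "\<dots> = ip (unit_mass u) (survival A t)" by (rule *)
  also have "\<dots> = (\<Sum>v\<in>V. if v = u then survival A t v else 0)"
    unfolding ip_def using assms deg_pos[of u]
    by (intro sum.cong) (auto simp: unit_mass_def)
  also have "\<dots> = survival A t u" using assms finite_V by simp
  finally show ?thesis .
qed

lemma green_nonneg: "0 \<le> green A u W v"
  unfolding green_def by (intro sum_nonneg killed_unit_mass_nonneg)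

lemma green_outside: "u \<in> V - A \<Longrightarrow> v \<notin> V - A \<Longrightarrow> green A u W v = 0"
  unfolding green_def by (simp add: killed_unit_mass_outside)

text \<open>Applying \<open>P\<close> shifts the sum by one time step. It loses the source term at
  time 0 and gains a nonnegative term at time \<open>Suc W\<close>, which is why only an inequality
  remains.\<close>

lemma green_subharmonic:
  assumes "v \<in> V - A"
  shows "green A u W v \<le> P (green A u W) v + unit_mass u v"
proof -
  define F where "F t = (killed A ^^ t) (unit_mass u)" for t
  have "P (green A u W) v = (\<Sum>t\<le>W. P (F t) v)"
    unfolding green_def[abs_def] P_sum F_def ..
  also have "\<dots> = (\<Sum>t\<le>W. F (Suc t) v)" using assms by (simp add: F_def killed_def)
  also have "\<dots> = (\<Sum>t\<le>Suc W. F t v) - F 0 v" by (simp only: sum.atMost_Suc_shift)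
  also have "\<dots> = green A u W v + F (Suc W) v - unit_mass u v"
    by (simp add: green_def F_def)
  finally show ?thesis using killed_unit_mass_nonneg[where A=A and t="Suc W" and u=u and v=v] unfolding F_def by linarith
qed

text \<open>Markov's inequality for the killing time: the right-hand side is the expected time spent
  outside \<open>A\<close> up to \<open>W\<close>, and survival probabilities decrease in
  time.\<close>

lemma survival_le_green:
  assumes "u \<in> V - A"
  shows "(real W + 1) * survival A W u \<le> (\<Sum>v\<in>V. deg v * green A u W v)"
proof -
  have "(real W + 1) * survival A W u = (\<Sum>t\<le>W. survival A W u)" by simp
  also have "\<dots> \<le> (\<Sum>t\<le>W. survival A t u)" by (intro sum_mono survival_antimono) auto
  also have "\<dots> = (\<Sum>t\<le>W. \<Sum>v\<in>V. deg v * (killed A ^^ t) (unit_mass u) v)"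
    by (simp add: sum_deg_killed[OF assms])
  also have "\<dots> = (\<Sum>v\<in>V. deg v * green A u W v)"
    unfolding green_def sum_distrib_left by (rule sum.swap)
  finally show ?thesis .
qed

section \<open>Volume, inner arcs and cut\<close>

lemma vol_eq_card: "S \<subseteq> V \<Longrightarrow> vol S = real (card (E \<inter> S \<times> UNIV))"
  using sum_arcs[of S "\<lambda>_ _. 1"] by (simp add: vol_def deg_def)

lemma vol_split: assumes "S \<subseteq> V" shows "vol S = inner S + cut S"
proof -
  have "E \<inter> S \<times> UNIV = (E \<inter> S \<times> S) \<union> (E \<inter> S \<times> (- S))" by auto
  then have "card (E \<inter> S \<times> UNIV) = card (E \<inter> S \<times> S) + card (E \<inter> S \<times> (- S))"
    using finite_E by (simp add: card_Un_disjoint disjoint_iff)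
  then show ?thesis using assms by (simp add: vol_eq_card inner_def cut_def)
qed

lemma vol_mono: "S \<subseteq> T \<Longrightarrow> T \<subseteq> V \<Longrightarrow> vol S \<le> vol T"
  unfolding vol_def using finite_V by (intro sum_mono2) (auto simp: deg_nonneg finite_subset)

lemma vol_nonneg: "0 \<le> vol S"
  unfolding vol_def by (intro sum_nonneg deg_nonneg)

lemma card_le_vol: assumes "S \<subseteq> V" shows "real (card S) \<le> vol S"
proof -
  have "real (card S) = (\<Sum>x\<in>S. 1)" by simp
  also have "\<dots> \<le> vol S" unfolding vol_def using assms deg_ge_1 by (intro sum_mono) auto
  finally show ?thesis .
qed

lemma vol_ge_1: assumes "S \<subseteq> V" "S \<noteq> {}" shows "1 \<le> vol S"
proof -
  have "1 \<le> card S" using assms finite_V by (metis One_nat_def Suc_leI card_gt_0_iff finite_subset)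
  then show ?thesis using card_le_vol[OF assms(1)] by linarith
qed

lemma vol_disjoint: "S \<subseteq> V \<Longrightarrow> T \<subseteq> V \<Longrightarrow> S \<inter> T = {} \<Longrightarrow> vol (S \<union> T) = vol S + vol T"
  unfolding vol_def using finite_V by (intro sum.union_disjoint) (auto intro: finite_subset)

lemma cut_compl: assumes "S \<subseteq> V" shows "cut (V - S) = cut S"
proof -
  have "E \<inter> (V - S) \<times> (- (V - S)) = (E \<inter> S \<times> (- S))\<inverse>"
    using assms by (auto dest: E_sym E_in_V)
  then show ?thesis by (simp add: cut_def)
qed

lemma cut_ge_1: assumes "S \<subseteq> V" "S \<noteq> {}" "S \<noteq> V" shows "1 \<le> cut S"
proof -
  obtain x y where "(x, y) \<in> E \<inter> S \<times> (- S)" using E_out[OF assms] by auto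
  then have "card (E \<inter> S \<times> (- S)) > 0" using finite_E by (auto simp: card_gt_0_iff)
  then show ?thesis by (simp add: cut_def)
qed

end

section \<open>Superlevel sets of a potential with one source\<close>

text \<open>Abstracts the truncated Green function: one unit source at \<open>u\<close>, and
  subharmonicity demanded only where \<open>g\<close> is positive, hence off the killing
  set.\<close>

locale source_potential = finite_sym_graph +
  fixes g :: "'a \<Rightarrow> real" and u :: 'a
  assumes g_nonneg: "0 \<le> g v"
    and u_in_V: "u \<in> V"
    and g_subharmonic: "v \<in> V \<Longrightarrow> 0 < g v \<Longrightarrow> g v \<le> P g v + unit_mass u v"
begin

definition level :: "real \<Rightarrow> 'a set" where "level s = {v \<in> V. s \<le> g v}"

lemma level_subset: "level s \<subseteq> V" by (auto simp: level_def)

lemma finite_level: "finite (level s)" using finite_V level_subset finite_subset by blast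

text \<open>Maximum principle. If part of the level set were unreachable from \<open>u\<close>
  inside it, the maximum of \<open>g\<close> on that part would spread from a maximiser to all its
  neighbours and so to all of \<open>V\<close>, including \<open>u\<close>.\<close>

lemma level_reachable:
  assumes "0 < s" and "v \<in> level s"
  shows "(u, v) \<in> (E \<inter> level s \<times> level s)\<^sup>*"
proof (rule ccontr)
  define S where "S = level s"
  define R where "R = {v. (u, v) \<in> (E \<inter> S \<times> S)\<^sup>*}"
  assume "(u, v) \<notin> (E \<inter> level s \<times> level s)\<^sup>*"
  then have v: "v \<in> S - R" using assms by (simp add: R_def S_def)
  have finS: "finite S" unfolding S_def by (rule finite_level)
  define M where "M = Max (g ` (S - R))"
  define Z where "Z = {v \<in> S - R. g v = M}"
  have "M \<in> g ` (S - R)" unfolding M_def using v finS by (intro Max_in) auto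
  then have Zne: "Z \<noteq> {}" by (auto simp: Z_def)
  have leM: "g y \<le> M" if "y \<in> S - R" for y unfolding M_def using that finS by (intro Max_ge) auto
  have sM: "s \<le> M" using leM[OF v] v by (auto simp: S_def level_def)
  have closed: "y \<in> Z" if z: "z \<in> Z" and zy: "(z, y) \<in> E" for z y
  proof -
    have zS: "z \<in> S" "z \<notin> R" "g z = M" and zV: "z \<in> V" using z by (auto simp: Z_def S_def level_def)
    have "u \<in> R" by (simp add: R_def)
    then have "z \<noteq> u" using zS by auto
    then have "g z \<le> P g z"
      using g_subharmonic[OF zV] zS sM assms(1) by (simp add: unit_mass_def)
    then have "deg z * g z \<le> deg z * P g z" by (intro mult_left_mono deg_nonneg)
    then have ge: "deg z * M \<le> (\<Sum>y\<in>E `` {z}. g y)" using zS by (simp add: deg_P[OF zV] mult.commute)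
    \<comment> \<open>A neighbour in the level set cannot be reachable, since \<open>z\<close> would
      be too; a neighbour outside it has value below \<open>s \<le> M\<close>.\<close>
    have nbr: "y' \<in> S - R \<or> (g y' < M \<and> y' \<notin> S)" if "(z, y') \<in> E" for y'
    proof (cases "y' \<in> S")
      case True
      have "y' \<notin> R"
      proof
        assume "y' \<in> R"
        moreover have "(y', z) \<in> E \<inter> S \<times> S" using True zS E_sym that by auto
        ultimately have "z \<in> R" unfolding R_def by (metis mem_Collect_eq rtrancl.rtrancl_into_rtrancl)
        then show False using zS by simp
      qed
      then show ?thesis using True by simp
    next
      case False
      then show ?thesis using sM E_in_V(2)[OF that] by (auto simp: S_def level_def)
    qed
    have le: "g y' \<le> M" if "(z, y') \<in> E" for y' using nbr[OF that] leM[of y'] by auto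
    have "g y = M"
    proof (rule ccontr)
      assume "g y \<noteq> M"
      then have "g y < M" using le[OF zy] by simp
      then have "(\<Sum>y\<in>E `` {z}. g y) < (\<Sum>y\<in>E `` {z}. M)"
        using zy le finite_nbrs by (intro sum_strict_mono_ex1) auto
      then show False using ge by (simp add: deg_def)
    qed
    then show ?thesis using nbr[OF zy] by (auto simp: Z_def)
  qed
  have "Z = V"
  proof (rule ccontr)
    assume "Z \<noteq> V"
    moreover have "Z \<subseteq> V" by (auto simp: Z_def S_def level_def)
    ultimately obtain x y where "x \<in> Z" "y \<in> V - Z" "(x, y) \<in> E" using E_out[of Z] Zne by auto
    then show False using closed by auto
  qed
  then show False using u_in_V by (auto simp: Z_def R_def)
qed

lemma source_in_level:
  assumes "0 < s" and "level s \<noteq> {}" shows "u \<in> level s"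
proof -
  obtain v where v: "v \<in> level s" using assms(2) by auto
  from level_reachable[OF assms(1) v] show ?thesis
  proof (cases rule: converse_rtranclE)
    case base then show ?thesis using v by simp
  qed auto
qed

text \<open>Currents inside the level set cancel in pairs, so the outflow is the sum of
  \<open>2 * deg x * (g x - P g x)\<close>, the 2 coming from laziness. Only the source contributes
  positively.\<close>

lemma current_out_of_level:
  assumes "0 < s"
  shows "(\<Sum>(x, y)\<in>E \<inter> level s \<times> (- level s). g x - g y) \<le> 2"
proof -
  let ?S = "level s"
  have "(\<Sum>(x, y)\<in>E \<inter> ?S \<times> ?S. g x - g y) = (\<Sum>(x, y)\<in>E \<inter> ?S \<times> ?S. g y - g x)"
    by (rule sum_arcs_swap) (use E_sym in auto)
  also have "\<dots> = - (\<Sum>(x, y)\<in>E \<inter> ?S \<times> ?S. g x - g y)"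
    by (simp add: sum_negf[symmetric] case_prod_unfold)
  finally have 0: "(\<Sum>(x, y)\<in>E \<inter> ?S \<times> ?S. g x - g y) = 0" by simp
  have "E \<inter> ?S \<times> UNIV = (E \<inter> ?S \<times> ?S) \<union> (E \<inter> ?S \<times> (- ?S))" by auto
  then have "(\<Sum>(x, y)\<in>E \<inter> ?S \<times> (- ?S). g x - g y) = (\<Sum>(x, y)\<in>E \<inter> ?S \<times> UNIV. g x - g y)"
    using 0 finite_E by (simp add: sum.union_disjoint disjoint_iff)
  also have "\<dots> = (\<Sum>x\<in>?S. \<Sum>y\<in>E `` {x}. g x - g y)"
    using sum_arcs[of "level s" "\<lambda>x y. g x - g y"] level_subset by simp
  also have "\<dots> \<le> (\<Sum>x\<in>?S. if x = u then 2 else 0)"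
  proof (rule sum_mono)
    fix x assume x: "x \<in> ?S"
    then have xV: "x \<in> V" and gx: "0 < g x" using assms by (auto simp: level_def)
    have "(\<Sum>y\<in>E `` {x}. g x - g y) = deg x * g x - (\<Sum>y\<in>E `` {x}. g y)"
      by (simp add: sum_subtractf deg_def)
    also have "\<dots> = 2 * (deg x * (g x - P g x))"
      using deg_P[OF xV, of g] by (simp add: algebra_simps)
    also have "\<dots> \<le> 2 * (deg x * unit_mass u x)"
      using g_subharmonic[OF xV gx] by (intro mult_left_mono deg_nonneg) auto
    also have "\<dots> = (if x = u then 2 else 0)" using deg_pos[OF xV] by (auto simp: unit_mass_def)
    finally show "(\<Sum>y\<in>E `` {x}. g x - g y) \<le> (if x = u then 2 else 0)" .
  qed
  also have "\<dots> \<le> 2" using finite_level by simp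
  finally show ?thesis .
qed

text \<open>At most half of the boundary arcs can carry a potential drop above \<open>4 / cut\<close>, so the heads of
  the other half already lie in the lower level set.\<close>

lemma level_growth:
  assumes "0 < s" and "0 < cut (level s)"
  shows "vol (level s) + cut (level s) / 2 \<le> vol (level (s - 4 / cut (level s)))"
proof -
  define S where "S = level s"
  define c where "c = cut S"
  define S' where "S' = level (s - 4 / c)"
  have c: "0 < c" using assms by (simp add: c_def S_def)
  have SS': "S \<subseteq> S'" using c by (auto simp: S_def S'_def level_def) (smt (verit) divide_pos_pos)
  have S'V: "S' \<subseteq> V" unfolding S'_def by (rule level_subset)
  define B where "B = E \<inter> S \<times> (- S)"
  define N where "N = B \<inter> UNIV \<times> S'"
  have finB: "finite B" using finite_E by (simp add: B_def)
  have Bpos: "0 \<le> g x - g y" if "(x, y) \<in> B" for x y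
    using that E_in_V(2) by (fastforce simp: B_def S_def level_def)
  have far: "4 / c \<le> g x - g y" if "(x, y) \<in> B - N" for x y
    using that E_in_V(2) by (fastforce simp: N_def B_def S_def S'_def level_def)
  have "real (card (B - N)) * (4 / c) = (\<Sum>(x, y)\<in>B - N. 4 / c)" by simp
  also have "\<dots> \<le> (\<Sum>(x, y)\<in>B - N. g x - g y)" using far by (intro sum_mono) auto
  also have "\<dots> \<le> (\<Sum>(x, y)\<in>B. g x - g y)" using finB Bpos by (intro sum_mono2) auto
  also have "\<dots> \<le> 2" unfolding B_def S_def by (rule current_out_of_level[OF assms(1)])
  finally have "real (card (B - N)) \<le> c / 2" using c by (simp add: field_simps)
  moreover have "card B = card (B - N) + card N"
    using finB by (metis Int_Diff_Un N_def card_Diff_subset card_mono finite_Int inf_le1 le_add_diff_inverse2)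
  moreover have "c = real (card B)" by (simp add: c_def cut_def B_def)
  ultimately have N: "c / 2 \<le> real (card N)" by simp
  \<comment> \<open>Reversed, the arcs of \<open>N\<close> start in \<open>S' - S\<close>, so their
    number is at most the volume gained.\<close>
  have "prod.swap ` N \<subseteq> E \<inter> (S' - S) \<times> UNIV" using E_sym by (auto simp: N_def B_def)
  then have "card (prod.swap ` N) \<le> card (E \<inter> (S' - S) \<times> UNIV)" using finite_E by (intro card_mono) auto
  moreover have "S' - S \<subseteq> V" using S'V by auto
  ultimately have "real (card N) \<le> vol (S' - S)" by (simp add: vol_eq_card card_image)
  moreover have "vol S' = vol S + vol (S' - S)"
  proof -
    have "S \<subseteq> V" "S' - S \<subseteq> V" "S \<inter> (S' - S) = {}" "S \<union> (S' - S) = S'" using SS' S'V by auto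
    then show ?thesis using vol_disjoint[of S "S' - S"] by simp
  qed
  ultimately show ?thesis using N by (simp add: S_def S'_def c_def)
qed

text \<open>For nonnegative \<open>s\<close> this is the integral of \<open>vol (level t)\<close>
  over \<open>t\<close> from 0 to \<open>s\<close>.\<close>

definition truncated :: "real \<Rightarrow> real" where
  "truncated s = (\<Sum>v\<in>V. deg v * min (g v) s)"

text \<open>Descend to the largest positive value of \<open>g\<close> at which the volume has grown
  by half the cut, or to 0 if there is none. By \<open>level_growth\<close> the drop is at most
  \<open>4 / c\<close>, and all layers above \<open>s'\<close> have volume at most
  \<open>p + c / 2\<close>; the product bounds the loss in \<open>truncated\<close>.\<close>

lemma level_step:
  assumes "0 < s" and "0 < cut (level s)"
  obtains s' where "0 \<le> s'" "s' < s"
    "truncated s \<le> truncated s' + 4 * vol (level s) / cut (level s) + 2"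
    "s' = 0 \<or> (level s' \<noteq> {} \<and> vol (level s) + cut (level s) / 2 \<le> vol (level s'))"
proof -
  define c where "c = cut (level s)"
  define p where "p = vol (level s)"
  have c: "0 < c" using assms by (simp add: c_def)
  define X where "X = {x \<in> g ` V. 0 < x \<and> p + c / 2 \<le> vol (level x)}"
  define s' where "s' = (if X = {} then 0 else Max X)"
  have finX: "finite X" using finite_V by (simp add: X_def)
  have s'X: "s' = 0 \<or> s' \<in> X" using Max_in[OF finX] by (auto simp: s'_def)
  have s'0: "0 \<le> s'" using s'X by (auto simp: X_def)
  have Xle: "x \<le> s'" if "x \<in> X" for x using that Max_ge[OF finX] by (auto simp: s'_def)
  have anti: "vol (level y) \<le> vol (level x)" if "x \<le> y" for x y
    using that by (intro vol_mono level_subset) (auto simp: level_def)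
  have s's: "s' < s"
    using s'X assms(1) anti[of s s'] c by (force simp: X_def p_def)
  \<comment> \<open>The least value of \<open>g\<close> above \<open>s'\<close> has exactly this set
    as its level set, and it is not in \<open>X\<close> because \<open>s'\<close> bounds
    \<open>X\<close>.\<close>
  have above_strict: "vol {v \<in> V. s' < g v} < p + c / 2" if "{v \<in> V. s' < g v} \<noteq> {}"
  proof -
    define x where "x = Min (g ` {v \<in> V. s' < g v})"
    have xin: "x \<in> g ` {v \<in> V. s' < g v}" unfolding x_def using that finite_V by (intro Min_in) auto
    have "level x = {v \<in> V. s' < g v}"
    proof -
      have "x \<le> g v" if "v \<in> V" "s' < g v" for v
        unfolding x_def using that finite_V by (intro Min_le) auto
      then show ?thesis using xin by (auto simp: level_def)
    qed
    moreover have "x \<notin> X" using Xle[of x] xin by auto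
    ultimately show ?thesis using xin s'0 by (auto simp: X_def)
  qed
  have above: "vol {v \<in> V. s' < g v} \<le> p + c / 2"
  proof (cases "{v \<in> V. s' < g v} = {}")
    case True
    have "vol {v \<in> V. s' < g v} = 0" unfolding True by (simp add: vol_def)
    then show ?thesis using vol_nonneg[of "level s"] c by (simp add: p_def)
  next
    case False
    then show ?thesis using above_strict by simp
  qed
  have drop: "s - s' \<le> 4 / c"
  proof (rule ccontr)
    assume "\<not> s - s' \<le> 4 / c"
    then have "level (s - 4 / c) \<subseteq> {v \<in> V. s' < g v}" by (auto simp: level_def)
    then have "vol (level (s - 4 / c)) \<le> vol {v \<in> V. s' < g v}" by (intro vol_mono) auto
    moreover have "p + c / 2 \<le> vol (level (s - 4 / c))"
      using level_growth[OF assms] by (simp add: p_def c_def)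
    moreover have "{v \<in> V. s' < g v} \<noteq> {}"
    proof
      assume "{v \<in> V. s' < g v} = {}"
      then have "vol {v \<in> V. s' < g v} = 0" by (simp only: vol_def sum.empty)
      then show False using calculation c vol_nonneg[of "level s"] by (simp add: p_def)
    qed
    ultimately show False using above_strict by linarith
  qed
  have "truncated s - truncated s' = (\<Sum>v\<in>V. deg v * (min (g v) s - min (g v) s'))"
    by (simp add: truncated_def sum_subtractf[symmetric] algebra_simps)
  also have "\<dots> \<le> (\<Sum>v\<in>V. if s' < g v then deg v * (s - s') else 0)"
    using s's by (intro sum_mono) (auto intro!: mult_left_mono simp: deg_nonneg)
  also have "\<dots> = (s - s') * vol {v \<in> V. s' < g v}"
    using finite_V by (simp add: vol_def sum.inter_filter[symmetric] sum_distrib_left mult.commute)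
  also have "\<dots> \<le> 4 / c * (p + c / 2)"
    using drop above s's c vol_nonneg by (intro mult_mono) auto
  also have "\<dots> = 4 * p / c + 2" using c by (simp add: field_simps)
  finally have "truncated s \<le> truncated s' + 4 * vol (level s) / cut (level s) + 2"
    by (simp add: p_def c_def)
  moreover have "s' = 0 \<or> (level s' \<noteq> {} \<and> vol (level s) + cut (level s) / 2 \<le> vol (level s'))"
    using s'X by (auto simp: X_def p_def c_def level_def)
  ultimately show thesis using that s'0 s's by blast
qed

text \<open>The logarithm pays for steps at which the volume grows by a constant factor, the linear term for
  the at most \<open>2 * p0 + 2\<close> steps at volume below \<open>p0\<close>, and the constants for the last step.\<close>

definition level_bound :: "real \<Rightarrow> real \<Rightarrow> real \<Rightarrow> real" where
  "level_bound c p0 p = (4 / c + 2) / ln (1 + c / 2) * (ln (vol V) - ln p)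
     + (8 * p0 + 4) * max 0 (p0 + 1 - p) + (4 / c + 2) + (4 * p0 + 2)"

text \<open>Induction on the number of vertices below \<open>s\<close>, as each
  \<open>level_step\<close> to a positive level adds vertices. A step costs at most
  \<open>4 / c + 2\<close> if the cut is a fixed fraction of the volume, and at most
  \<open>4 * p0 + 2\<close> if the volume is at most \<open>p0\<close>; \<open>level_bound\<close>
  falls by at least as much.\<close>

lemma truncated_le:
  assumes "0 < c" and "0 \<le> p0"
    and iso: "\<And>s. 0 < s \<Longrightarrow> level s \<noteq> {} \<Longrightarrow> 1 \<le> cut (level s) \<and> (c * vol (level s) \<le> cut (level s) \<or> vol (level s) \<le> p0)"
    and "0 < s" and "level s \<noteq> {}"
  shows "truncated s \<le> level_bound c p0 (vol (level s))"
  using assms(4,5)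
proof (induction "card {v \<in> V. g v < s}" arbitrary: s rule: less_induct)
  case less
  define p where "p = vol (level s)"
  define b where "b = cut (level s)"
  define K where "K = (4 / c + 2) / ln (1 + c / 2)"
  have lnpos: "0 < ln (1 + c / 2)" using assms(1) by simp
  have K0: "0 \<le> K" using assms(1) lnpos by (simp add: K_def)
  have b1: "1 \<le> b" and bc: "c * p \<le> b \<or> p \<le> p0" using iso[OF less.prems] by (auto simp: b_def p_def)
  have vol1: "1 \<le> vol (level s)" if "level s \<noteq> {}" for s
    using level_subset that by (rule vol_ge_1)
  have p1: "1 \<le> p" unfolding p_def by (rule vol1[OF less.prems(2)])
  have pM: "p \<le> vol V" unfolding p_def by (intro vol_mono level_subset) auto
  have cost: "4 * p / b + 2 \<le> 4 / c + 2 \<and> c * p \<le> b \<or> 4 * p / b + 2 \<le> 4 * p0 + 2 \<and> p \<le> p0"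
    using bc
  proof
    assume "c * p \<le> b"
    then show ?thesis using assms(1) b1 by (simp add: field_simps)
  next
    assume "p \<le> p0"
    moreover have "4 * p / b \<le> 4 * p" using b1 p1 by (simp add: divide_le_eq)
    ultimately show ?thesis by simp
  qed
  have "0 < cut (level s)" using b1 by (simp add: b_def)
  then obtain s' where s': "0 \<le> s'" "s' < s" "truncated s \<le> truncated s' + 4 * p / b + 2"
      "s' = 0 \<or> (level s' \<noteq> {} \<and> p + b / 2 \<le> vol (level s'))"
    unfolding p_def b_def by (rule level_step[OF less.prems(1)])
  show ?case
  proof (cases "s' = 0")
    case True
    have "truncated 0 = 0" using g_nonneg by (simp add: truncated_def min_absorb2)
    then have "truncated s \<le> 4 * p / b + 2" using s' True by simp
    also have "\<dots> \<le> (4 / c + 2) + (4 * p0 + 2)"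
      using cost assms(1,2) by (smt (verit) divide_pos_pos)
    also have "\<dots> \<le> level_bound c p0 p"
      unfolding level_bound_def K_def[symmetric] using K0 p1 pM assms(2) by simp
    finally show ?thesis by (simp add: p_def)
  next
    case False
    define p' where "p' = vol (level s')"
    have p': "p + b / 2 \<le> p'" and ne: "level s' \<noteq> {}" using s' False by (auto simp: p'_def)
    obtain v where v: "v \<in> level s'" "v \<notin> level s"
    proof -
      have "\<not> level s' \<subseteq> level s"
      proof
        assume "level s' \<subseteq> level s"
        then have "p' \<le> p" unfolding p_def p'_def by (intro vol_mono level_subset)
        then show False using p' b1 by simp
      qed
      then show thesis using that by auto
    qed
    have "v \<in> {v \<in> V. g v < s}" "v \<notin> {v \<in> V. g v < s'}" using v by (auto simp: level_def)
    moreover have "{v \<in> V. g v < s'} \<subseteq> {v \<in> V. g v < s}" using s'(2) by auto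
    ultimately have "{v \<in> V. g v < s'} \<subset> {v \<in> V. g v < s}" by blast
    then have "card {v \<in> V. g v < s'} < card {v \<in> V. g v < s}" using finite_V by (intro psubset_card_mono) auto
    then have "truncated s' \<le> level_bound c p0 p'"
      unfolding p'_def using s' False ne by (intro less.hyps) auto
    moreover have "level_bound c p0 p' + (4 * p / b + 2) \<le> level_bound c p0 p"
    proof -
      have lnle: "ln p \<le> ln p'" using p' p1 b1 by simp
      have maxle: "max 0 (p0 + 1 - p') \<le> max 0 (p0 + 1 - p)" using p' b1 by auto
      have "4 * p / b + 2 \<le> K * (ln p' - ln p) + (8 * p0 + 4) * (max 0 (p0 + 1 - p) - max 0 (p0 + 1 - p'))"
        using cost
      proof (elim disjE conjE)
        assume 1: "4 * p / b + 2 \<le> 4 / c + 2" and 2: "c * p \<le> b"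
        have "p * (1 + c / 2) \<le> p'" using 2 p' by (simp add: algebra_simps)
        then have "ln (p * (1 + c / 2)) \<le> ln p'" using p1 assms(1) by (intro ln_mono) auto
        then have "ln (1 + c / 2) \<le> ln p' - ln p" using p1 assms(1) by (simp add: ln_mult)
        then have "K * ln (1 + c / 2) \<le> K * (ln p' - ln p)" using K0 by (intro mult_left_mono)
        moreover have "K * ln (1 + c / 2) = 4 / c + 2" using lnpos by (simp add: K_def)
        moreover have "0 \<le> (8 * p0 + 4) * (max 0 (p0 + 1 - p) - max 0 (p0 + 1 - p'))"
          using maxle assms(2) by simp
        ultimately show ?thesis using 1 by linarith
      next
        assume 1: "4 * p / b + 2 \<le> 4 * p0 + 2" and 2: "p \<le> p0"
        \<comment> \<open>The volume grows by \<open>b / 2 \<ge> 1 / 2\<close>. The offset in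
          \<open>p0 + 1\<close> leaves slack 1 at \<open>p = p0\<close>, so the truncation by 0
          cannot swallow this growth.\<close>
        have "1 / 2 \<le> max 0 (p0 + 1 - p) - max 0 (p0 + 1 - p')" using 2 p' b1 by (simp add: max_def)
        then have "(8 * p0 + 4) * (1 / 2) \<le> (8 * p0 + 4) * (max 0 (p0 + 1 - p) - max 0 (p0 + 1 - p'))"
          using assms(2) by (intro mult_left_mono) auto
        then have 3: "4 * p0 + 2 \<le> (8 * p0 + 4) * (max 0 (p0 + 1 - p) - max 0 (p0 + 1 - p'))"
          by simp
        have "0 \<le> K * (ln p' - ln p)" using K0 lnle by simp
        then show ?thesis by (rule add_increasing[OF _ order_trans[OF 1 3]])
      qed
      then show ?thesis unfolding level_bound_def K_def[symmetric] by (simp add: algebra_simps)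
    qed
    ultimately show ?thesis using s'(3) by (simp add: p_def)
  qed
qed

lemma total_potential_le:
  assumes "0 < c" and "0 \<le> p0"
    and "\<And>s. 0 < s \<Longrightarrow> level s \<noteq> {} \<Longrightarrow> 1 \<le> cut (level s) \<and> (c * vol (level s) \<le> cut (level s) \<or> vol (level s) \<le> p0)"
  shows "(\<Sum>v\<in>V. deg v * g v) \<le> (4 / c + 2) / ln (1 + c / 2) * ln (vol V)
           + (8 * p0 + 4) * (p0 + 1) + (4 / c + 2) + (4 * p0 + 2)"
proof -
  \<comment> \<open>At the maximum of \<open>g\<close> nothing is truncated, so the descent from
    there bounds the whole sum.\<close>
  define s where "s = Max (g ` V)"
  have "s \<in> g ` V" unfolding s_def using u_in_V finite_V by (intro Max_in) auto
  then have ne: "level s \<noteq> {}" by (auto simp: level_def)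
  have le: "g v \<le> s" if "v \<in> V" for v unfolding s_def using that finite_V by (intro Max_ge) auto
  have tr: "(\<Sum>v\<in>V. deg v * g v) = truncated s" unfolding truncated_def using le by (intro sum.cong) auto
  have "V \<noteq> {}" using u_in_V by auto
  have vol1: "1 \<le> vol S" if "S \<subseteq> V" "S \<noteq> {}" for S
    using that by (rule vol_ge_1)
  have K0: "0 \<le> (4 / c + 2) / ln (1 + c / 2)" using assms(1) by simp
  have lnV: "0 \<le> ln (vol V)" using vol1[of V] \<open>V \<noteq> {}\<close> by simp
  show ?thesis
  proof (cases "0 < s")
    case True
    define p where "p = vol (level s)"
    have p1: "1 \<le> p" unfolding p_def by (rule vol1[OF level_subset ne])
    have "truncated s \<le> level_bound c p0 p"
      unfolding p_def using assms(3) by (rule truncated_le[OF assms(1,2)]) (use True ne in auto)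
    moreover have "(4 / c + 2) / ln (1 + c / 2) * (ln (vol V) - ln p) \<le> (4 / c + 2) / ln (1 + c / 2) * ln (vol V)"
      using K0 p1 by (intro mult_left_mono) auto
    moreover have "(8 * p0 + 4) * max 0 (p0 + 1 - p) \<le> (8 * p0 + 4) * (p0 + 1)"
      using assms(2) p1 by (intro mult_left_mono) auto
    ultimately show ?thesis unfolding tr level_bound_def by linarith
  next
    case False
    then have "g v = 0" if "v \<in> V" for v using le[OF that] g_nonneg[of v] by simp
    then have "(\<Sum>v\<in>V. deg v * g v) = 0" by simp
    moreover have "0 \<le> (4 / c + 2) / ln (1 + c / 2) * ln (vol V)" using K0 lnV by (rule mult_nonneg_nonneg)
    moreover have "0 \<le> (8 * p0 + 4) * (p0 + 1)" using assms(2) by simp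
    moreover have "0 \<le> 4 / c" using assms(1) by simp
    ultimately show ?thesis using assms(2) by linarith
  qed
qed

end

section \<open>From hitting times to mixing\<close>

context finite_sym_graph begin

text \<open>Apply \<open>total_potential_le\<close> to the truncated Green function. Its positive
  level sets avoid \<open>A\<close>, contain \<open>u\<close> and are connected to \<open>u\<close>
  from within, so \<open>iso\<close> speaks only of such sets; their cut is at least 1 because
  \<open>A\<close> meets \<open>V\<close>.\<close>

lemma survival_bound:
  assumes "u \<in> V - A" and "A \<inter> V \<noteq> {}" and "0 < c" and "0 \<le> p0"
    and iso: "\<And>S. S \<subseteq> V - A \<Longrightarrow> u \<in> S \<Longrightarrow> (\<And>v. v \<in> S \<Longrightarrow> (u, v) \<in> (E \<inter> S \<times> S)\<^sup>*) \<Longrightarrow>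
           c * vol S \<le> cut S \<or> vol S \<le> p0"
  shows "(real W + 1) * survival A W u \<le> (4 / c + 2) / ln (1 + c / 2) * ln (vol V)
           + (8 * p0 + 4) * (p0 + 1) + (4 / c + 2) + (4 * p0 + 2)"
proof -
  interpret g: source_potential V E "green A u W" u
  proof
    fix v assume v: "v \<in> V" "0 < green A u W v"
    then have "v \<in> V - A" using green_outside[OF assms(1), of v W] by fastforce
    then show "green A u W v \<le> P (green A u W) v + unit_mass u v" by (rule green_subharmonic)
  qed (use assms(1) green_nonneg in auto)
  have "1 \<le> cut (g.level s) \<and> (c * vol (g.level s) \<le> cut (g.level s) \<or> vol (g.level s) \<le> p0)"
    if s: "0 < s" and ne: "g.level s \<noteq> {}" for s
  proof -
    have sub: "g.level s \<subseteq> V - A"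
      using green_outside[OF assms(1)] s by (force simp: g.level_def)
    have "1 \<le> cut (g.level s)" using sub ne assms(2) by (intro cut_ge_1) auto
    moreover have "c * vol (g.level s) \<le> cut (g.level s) \<or> vol (g.level s) \<le> p0"
      using sub g.source_in_level[OF s ne] g.level_reachable[OF s] by (rule iso)
    ultimately show ?thesis by blast
  qed
  then have "(\<Sum>v\<in>V. deg v * green A u W v) \<le> (4 / c + 2) / ln (1 + c / 2) * ln (vol V)
           + (8 * p0 + 4) * (p0 + 1) + (4 / c + 2) + (4 * p0 + 2)"
    by (intro g.total_potential_le assms) auto
  with survival_le_green[OF assms(1), of W] show ?thesis by linarith
qed

lemma vol_Diff: "S \<subseteq> V \<Longrightarrow> vol (V - S) = vol V - vol S"
  unfolding vol_def using finite_V by (simp add: sum_diff)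

lemma vol_V_pos: "0 < vol V"
proof -
  have "V \<noteq> {}" using V_nontrivial by auto
  then show ?thesis using vol_ge_1[of V] by simp
qed

text \<open>Take the largest value of \<open>h\<close> whose upper tail has half the volume. The
  next larger value fails this, so the strict upper tail has at most half.\<close>

lemma median_exists:
  fixes h :: "'a \<Rightarrow> real"
  obtains m where "m \<in> h ` V" "vol V / 2 \<le> vol {x \<in> V. m \<le> h x}" "vol V / 2 \<le> vol {x \<in> V. h x \<le> m}"
proof -
  define X where "X = {m \<in> h ` V. vol V / 2 \<le> vol {x \<in> V. m \<le> h x}}"
  have Vne: "h ` V \<noteq> {}" using V_nontrivial by auto
  have finX: "finite X" using finite_V by (simp add: X_def)
  have "Min (h ` V) \<in> X"
  proof -
    have "{x \<in> V. Min (h ` V) \<le> h x} = V" using finite_V by auto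
    then show ?thesis using Min_in[OF _ Vne] finite_V vol_V_pos by (simp add: X_def)
  qed
  then have "Max X \<in> X" using finX by (intro Max_in) auto
  define m where "m = Max X"
  have mX: "m \<in> X" using \<open>Max X \<in> X\<close> by (simp add: m_def)
  have "vol {x \<in> V. m < h x} \<le> vol V / 2"
  proof (cases "{x \<in> V. m < h x} = {}")
    case True
    then have "vol {x \<in> V. m < h x} = 0" by (simp only: vol_def sum.empty)
    then show ?thesis using vol_V_pos by simp
  next
    case False
    define y where "y = Min (h ` {x \<in> V. m < h x})"
    have yin: "y \<in> h ` {x \<in> V. m < h x}" unfolding y_def using False finite_V by (intro Min_in) auto
    have "y \<le> h x" if "x \<in> V" "m < h x" for x unfolding y_def using that finite_V by (intro Min_le) auto
    then have "{x \<in> V. y \<le> h x} = {x \<in> V. m < h x}" using yin by auto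
    moreover have "y \<notin> X"
    proof
      assume "y \<in> X"
      then have "y \<le> m" unfolding m_def using finX by (intro Max_ge)
      then show False using yin by auto
    qed
    ultimately show ?thesis using yin by (auto simp: X_def)
  qed
  moreover have "V - {x \<in> V. m < h x} = {x \<in> V. h x \<le> m}" by auto
  ultimately have "vol V / 2 \<le> vol {x \<in> V. h x \<le> m}"
    using vol_Diff[of "{x \<in> V. m < h x}"] by auto
  then show thesis using mX that by (auto simp: X_def)
qed

text \<open>With \<open>a \<le> 1\<close> the factor in \<open>Pn_ge_hitting\<close> costs at most
  \<delta>; for negative \<open>a\<close> nonnegativity of \<open>f\<close> suffices.\<close>

lemma Pn_ge_of_survival:
  assumes "\<And>j y. j \<le> W \<Longrightarrow> y \<in> A \<inter> V \<Longrightarrow> a \<le> (P ^^ (s + j)) f y"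
    and "a \<le> 1" and "\<And>y. y \<in> V \<Longrightarrow> 0 \<le> f y" and "x \<in> V" and "survival A W x \<le> \<delta>"
  shows "a - \<delta> \<le> (P ^^ (s + W)) f x"
proof (cases "0 \<le> a")
  case True
  have "a * survival A W x \<le> 1 * survival A W x"
    using assms(2) survival_nonneg by (rule mult_right_mono)
  then have "a - \<delta> \<le> a * (1 - survival A W x)" using assms(5) by (simp add: algebra_simps)
  also have "\<dots> \<le> (P ^^ (s + W)) f x"
    using assms(1) True assms(3,4) by (rule Pn_ge_hitting)
  finally show ?thesis .
next
  case False
  have "0 \<le> (P ^^ (s + W)) f x"
    using Pn_mono[of "\<lambda>_. 0" f x "s + W"] assms(3,4) by (simp add: Pn_const)
  then show ?thesis using False assms(5) survival_nonneg[of A W x] by linarith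
qed

text \<open>Stationarity of the degree measure: self-adjointness moves the steps onto the constant
  function, which they fix.\<close>

lemma ip_const_Pn: "ip (\<lambda>_. 1) ((P ^^ n) f) = ip (\<lambda>_. 1) f"
proof -
  have "ip (\<lambda>_. 1) ((P ^^ n) f) = ip ((P ^^ n) (\<lambda>_. 1)) f" by (rule ip_Pn_commute)
  also have "\<dots> = ip (\<lambda>_. 1) f" unfolding ip_def by (intro sum.cong) (auto simp: Pn_const)
  finally show ?thesis .
qed

text \<open>After time \<open>s\<close> the function \<open>P ^^ s\<close> \<open>f\<close> hardly changes during a window of length \<open>W\<close> outside a
  set of small volume. A walk from a point of \<open>H\<close> meets within this window both the part where it is
  at least its median and the part where it is at most its median.\<close>

lemma Pn_near_mean:
  assumes f: "\<And>y. y \<in> V \<Longrightarrow> 0 \<le> f y" "\<And>y. y \<in> V \<Longrightarrow> f y \<le> 1"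
    and "0 < \<delta>" and Ws: "10 * real W \<le> (2 * real s + 1) * \<delta>\<^sup>2"
    and "H \<subseteq> V" and volH: "vol (V - H) \<le> \<delta> * vol V"
    and surv: "\<And>A x. A \<subseteq> V \<Longrightarrow> 2 / 5 * vol V \<le> vol A \<Longrightarrow> x \<in> H \<Longrightarrow> survival A W x \<le> \<delta>"
    and "x \<in> H"
  shows "\<bar>(P ^^ (s + W)) f x - ip (\<lambda>_. 1) f / vol V\<bar> \<le> 5 * \<delta>"
proof -
  define h where "h = (P ^^ s) f"
  define N where "N = {x\<in>V. \<exists>j\<le>W. \<delta> < \<bar>(P ^^ (s + j)) f x - h x\<bar>}"
  have f': "\<bar>f y\<bar> \<le> 1" if "y \<in> V" for y using f[OF that] by simp
  have "vol N * ((2 * real s + 1) * \<delta>\<^sup>2) \<le> real W * vol V"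
    unfolding N_def h_def by (rule slow_variation[OF \<open>0 < \<delta>\<close>]) (rule f')
  also have "\<dots> \<le> (2 * real s + 1) * \<delta>\<^sup>2 / 10 * vol V"
    using Ws vol_V_pos by (intro mult_right_mono) auto
  also have "\<dots> = vol V / 10 * ((2 * real s + 1) * \<delta>\<^sup>2)" by simp
  finally have volN: "vol N \<le> vol V / 10"
    using \<open>0 < \<delta>\<close> by (subst (asm) mult_le_cancel_right_pos) auto
  have NV: "N \<subseteq> V" by (auto simp: N_def)
  obtain m where m: "m \<in> h ` V" "vol V / 2 \<le> vol {x \<in> V. m \<le> h x}" "vol V / 2 \<le> vol {x \<in> V. h x \<le> m}"
    by (rule median_exists)
  \<comment> \<open>Removing a tenth of the volume from a half leaves the fraction 2/5 required by
    \<open>surv\<close>.\<close>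
  have large: "2 / 5 * vol V \<le> vol (B - N)" if "B \<subseteq> V" "vol V / 2 \<le> vol B" for B
  proof -
    have "vol B \<le> vol (B - N \<union> N)" using that NV by (intro vol_mono) auto
    also have "\<dots> = vol (B - N) + vol N" using that NV by (intro vol_disjoint) auto
    finally show ?thesis using that volN by simp
  qed
  have near: "\<bar>(P ^^ (s + j)) f y - h y\<bar> \<le> \<delta>" if "y \<in> V - N" "j \<le> W" for y j
    using that by (auto simp: N_def not_less)
  have Pn01: "0 \<le> (P ^^ n) f y" "(P ^^ n) f y \<le> 1" if "y \<in> V" for n y
    using Pn_mono[of "\<lambda>_. 0" f y n] Pn_mono[of f "\<lambda>_. 1" y n] f that by (auto simp: Pn_const)
  have m01: "0 \<le> m" "m \<le> 1" using m(1) Pn01 by (auto simp: h_def)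
  \<comment> \<open>Passing to \<open>1 - f\<close> turns the lower bound from hitting into the
    upper bound.\<close>
  have compl: "(P ^^ n) (\<lambda>y. 1 - f y) y = 1 - (P ^^ n) f y" if "y \<in> V" for n y
    unfolding Pn_diff using that by (simp add: Pn_const)
  have good: "\<bar>(P ^^ (s + W)) f y - m\<bar> \<le> 2 * \<delta>" if "y \<in> H" for y
  proof -
    have yV: "y \<in> V" using that \<open>H \<subseteq> V\<close> by auto
    define A where "A = {x \<in> V. m \<le> h x} - N"
    have "2 / 5 * vol V \<le> vol A" unfolding A_def by (rule large) (use m in auto)
    then have "survival A W y \<le> \<delta>"
      using that by (intro surv) (auto simp: A_def)
    have low: "m - \<delta> - \<delta> \<le> (P ^^ (s + W)) f y"
    proof (rule Pn_ge_of_survival)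
      show "m - \<delta> \<le> (P ^^ (s + j)) f z" if "j \<le> W" "z \<in> A \<inter> V" for j z
        using near[of z j] that by (auto simp: A_def)
      show "m - \<delta> \<le> 1" using m01 \<open>0 < \<delta>\<close> by simp
    qed (fact f(1) yV \<open>survival A W y \<le> \<delta>\<close>)+
    define B where "B = {x \<in> V. h x \<le> m} - N"
    have "2 / 5 * vol V \<le> vol B" unfolding B_def by (rule large) (use m in auto)
    then have "survival B W y \<le> \<delta>"
      using that by (intro surv) (auto simp: B_def)
    have "1 - m - \<delta> - \<delta> \<le> (P ^^ (s + W)) (\<lambda>y. 1 - f y) y"
    proof (rule Pn_ge_of_survival)
      show "1 - m - \<delta> \<le> (P ^^ (s + j)) (\<lambda>y. 1 - f y) z" if "j \<le> W" "z \<in> B \<inter> V" for j z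
        using near[of z j] that by (auto simp: B_def compl)
      show "1 - m - \<delta> \<le> 1" using m01 \<open>0 < \<delta>\<close> by simp
      show "0 \<le> 1 - f z" if "z \<in> V" for z using f(2)[OF that] by simp
    qed (fact yV \<open>survival B W y \<le> \<delta>\<close>)+
    then show ?thesis using low yV by (simp add: compl)
  qed
  \<comment> \<open>\<open>F\<close> has the same mean as \<open>f\<close>. It is within
    \<open>2 * \<delta>\<close> of \<open>m\<close> on \<open>H\<close> and within 1 elsewhere, so
    the mean is within \<open>3 * \<delta>\<close> of \<open>m\<close>.\<close>
  define F where "F = (P ^^ (s + W)) f"
  have "ip (\<lambda>_. 1) f = ip (\<lambda>_. 1) F" unfolding F_def by (rule ip_const_Pn[symmetric])
  then have "ip (\<lambda>_. 1) f - m * vol V = (\<Sum>y\<in>V. deg y * (F y - m))"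
    by (simp add: ip_def vol_def sum_distrib_left sum_subtractf[symmetric] algebra_simps)
  also have "\<bar>\<dots>\<bar> \<le> (\<Sum>y\<in>V. \<bar>deg y * (F y - m)\<bar>)" by (rule sum_abs)
  also have "\<dots> \<le> (\<Sum>y\<in>V. deg y * (2 * \<delta>) + (if y \<in> V - H then deg y else 0))"
  proof (rule sum_mono)
    fix y assume y: "y \<in> V"
    have "\<bar>F y - m\<bar> \<le> 2 * \<delta> + (if y \<in> V - H then 1 else 0)"
    proof (cases "y \<in> H")
      case True then show ?thesis using good by (simp add: F_def)
    next
      case False
      then show ?thesis using Pn01[OF y, of "s + W"] m01 \<open>0 < \<delta>\<close> y by (auto simp: F_def)
    qed
    then have "deg y * \<bar>F y - m\<bar> \<le> deg y * (2 * \<delta> + (if y \<in> V - H then 1 else 0))"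
      by (intro mult_left_mono deg_nonneg)
    then show "\<bar>deg y * (F y - m)\<bar> \<le> deg y * (2 * \<delta>) + (if y \<in> V - H then deg y else 0)"
      using y by (cases "y \<in> H") (simp_all add: abs_mult deg_nonneg distrib_left)
  qed
  also have "\<dots> = 2 * \<delta> * vol V + vol (V - H)"
  proof -
    have "(\<Sum>y\<in>V. if y \<in> V - H then deg y else 0) = vol (V - H)"
      unfolding vol_def using finite_V by (intro sum.mono_neutral_cong_right) auto
    then show ?thesis by (simp add: sum.distrib vol_def sum_distrib_right[symmetric] mult.commute)
  qed
  also have "\<dots> \<le> 3 * \<delta> * vol V" using volH by (simp add: algebra_simps)
  finally have "\<bar>ip (\<lambda>_. 1) f - m * vol V\<bar> \<le> 3 * \<delta> * vol V" .
  moreover have "ip (\<lambda>_. 1) f / vol V - m = (ip (\<lambda>_. 1) f - m * vol V) / vol V"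
    using vol_V_pos by (simp add: field_simps)
  ultimately have "\<bar>ip (\<lambda>_. 1) f / vol V - m\<bar> \<le> 3 * \<delta>"
    using vol_V_pos by (simp add: abs_divide divide_le_eq)
  then show ?thesis using good[OF \<open>x \<in> H\<close>] by linarith
qed

section \<open>Arc counts inside vertex sets\<close>

lemma finite_E_Int: "finite (E \<inter> X)"
  using finite_E by simp

text \<open>Grow a tree: by \<open>E_out\<close> some vertex outside \<open>S\<close> is adjacent to
  \<open>S\<close>, and adding it brings two new arcs.\<close>

lemma exists_inner_ge:
  assumes "1 \<le> k" and "k \<le> card V"
  shows "\<exists>S\<subseteq>V. card S = k \<and> 2 * (real k - 1) \<le> inner S"
  using assms
proof (induction k rule: nat_induct_at_least)
  case base
  obtain x where "x \<in> V" using V_nontrivial by fastforce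
  then show ?case by (intro exI[of _ "{x}"]) (auto simp: inner_def)
next
  case (Suc k)
  then obtain S where S: "S \<subseteq> V" "card S = k" "2 * (real k - 1) \<le> inner S" by auto
  have "S \<noteq> {}" "S \<noteq> V" using S Suc by auto
  then obtain x y where xy: "x \<in> S" "y \<in> V - S" "(x, y) \<in> E" using E_out[OF S(1)] by auto
  have fS: "finite S" using S finite_V finite_subset by blast
  let ?S = "insert y S"
  have "(E \<inter> S \<times> S) \<union> {(x, y), (y, x)} \<subseteq> E \<inter> ?S \<times> ?S" using xy E_sym by auto
  then have "card ((E \<inter> S \<times> S) \<union> {(x, y), (y, x)}) \<le> card (E \<inter> ?S \<times> ?S)"
    by (rule card_mono[OF finite_E_Int])
  moreover have "card ((E \<inter> S \<times> S) \<union> {(x, y), (y, x)}) = card (E \<inter> S \<times> S) + card {(x, y), (y, x)}"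
    using xy by (intro card_Un_disjoint finite_E_Int) auto
  moreover have "card {(x, y), (y, x)} = 2"
  proof -
    have "x \<noteq> y" using xy by auto
    then show ?thesis by simp
  qed
  ultimately have "inner S + 2 \<le> inner ?S" by (simp add: inner_def)
  moreover have "card ?S = Suc k" using S fS xy by simp
  ultimately show ?case using S xy by (intro exI[of _ ?S]) auto
qed

lemma inner_mono: "S \<subseteq> T \<Longrightarrow> inner S \<le> inner T"
  unfolding inner_def of_nat_le_iff by (rule card_mono[OF finite_E_Int]) auto

lemma inner_le_square: assumes "S \<subseteq> V" shows "inner S \<le> (real (card S))\<^sup>2"
proof -
  have "finite S" using assms finite_V finite_subset by blast
  then have "card (E \<inter> S \<times> S) \<le> card (S \<times> S)" by (intro card_mono) auto
  then show ?thesis unfolding inner_def card_cartesian_product power2_eq_square by (metis of_nat_le_iff of_nat_mult)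
qed

lemma vol_V_eq_inner: "vol V = inner V"
proof -
  have "E \<inter> V \<times> - V = {}" using E_subset by auto
  then show ?thesis using vol_split[of V] by (simp add: cut_def)
qed

lemma vol_V_ge: "2 * (real (card V) - 1) \<le> vol V"
proof -
  obtain S where S: "S \<subseteq> V" "2 * (real (card V) - 1) \<le> inner S"
    using exists_inner_ge[of "card V"] V_nontrivial by auto
  then show ?thesis using inner_mono[of S V] by (simp add: vol_V_eq_inner)
qed

end

section \<open>Walks on pair graphs\<close>

locale connected_pair_graph = pair_graph G for G :: "'a pair_pre_digraph" +
  assumes conn: "graph_connected G"
    and nontrivial: "2 \<le> card (pverts G)"

text \<open>For \<open>E_out\<close>: a set without outgoing arcs would be closed under
  reachability. Symmetrising changes nothing, the arcs being symmetric already.\<close>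

sublocale connected_pair_graph \<subseteq> finite_sym_graph "pverts G" "parcs G"
proof
  show "finite (pverts G)" by (rule pair_finite_verts)
  show "parcs G \<subseteq> pverts G \<times> pverts G" using in_arcsD1 in_arcsD2 by auto
  show "(y, x) \<in> parcs G" if "(x, y) \<in> parcs G" for x y using that by (rule arcs_symmetric)
  show "2 \<le> card (pverts G)" by (rule nontrivial)
  fix S assume S: "S \<subseteq> pverts G" "S \<noteq> {}" "S \<noteq> pverts G"
  show "\<exists>x\<in>S. \<exists>y\<in>pverts G - S. (x, y) \<in> parcs G"
  proof (rule ccontr)
    assume neg: "\<not> ?thesis"
    obtain a b where a: "a \<in> S" and b: "b \<in> pverts G - S" using S by auto
    have "strongly_connected (with_proj (mk_symmetric (with_proj G)))"
      using conn by (simp add: graph_connected_def Digraph_Component.connected_def)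
    then have "reachable (with_proj (mk_symmetric (with_proj G))) a b"
      using a b S by (auto simp: strongly_connected_def mk_symmetric_def)
    from Digraph.reachable_rtranclI[OF this]
    have "(a, b) \<in> (parcs (mk_symmetric (with_proj G)))\<^sup>*" by simp
    moreover have "parcs (mk_symmetric (with_proj G)) = parcs G"
      using arcs_symmetric by (force simp: mk_symmetric_def)
    ultimately have "(a, b) \<in> (parcs G)\<^sup>*" by simp
    then have "b \<in> S"
    proof (induction rule: rtrancl_induct)
      case base show ?case by (rule a)
    next
      case (step y z)
      then show ?case using neg in_arcsD2[OF step(2)] by blast
    qed
    then show False using b by simp
  qed
qed

context connected_pair_graph begin

lemma connected_in_of_reachable:
  assumes "S \<subseteq> pverts G" and "u \<in> S" and reach: "\<And>v. v \<in> S \<Longrightarrow> (u, v) \<in> (parcs G \<inter> S \<times> S)\<^sup>*"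
  shows "connected_in G S"
proof -
  let ?M = "mk_symmetric (with_proj G \<restriction> S)"
  have arcs: "parcs ?M = parcs G \<inter> S \<times> S"
    using arcs_symmetric by (force simp: mk_symmetric_def)
  have verts: "pverts ?M = S" by (simp add: mk_symmetric_def)
  have "sym (parcs G \<inter> S \<times> S)" using arcs_symmetric by (auto intro: symI)
  then have sym: "sym ((parcs G \<inter> S \<times> S)\<^sup>*)" by (rule sym_rtrancl)
  have "(a, b) \<in> rtrancl_on S (parcs G \<inter> S \<times> S)" if "a \<in> S" "b \<in> S" for a b
  proof (rule rtrancl_consistent_rtrancl_on)
    have "(a, u) \<in> (parcs G \<inter> S \<times> S)\<^sup>*" using reach[OF that(1)] sym by (auto dest: symD)
    then show "(a, b) \<in> (parcs G \<inter> S \<times> S)\<^sup>*" using reach[OF that(2)] by simp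
  qed (use that in auto)
  then show ?thesis
    using assms(2) unfolding connected_in_def Digraph_Component.connected_def strongly_connected_def Digraph.reachable_def
    by (auto simp: arcs verts)
qed

section \<open>Degrees, edges and boundaries in terms of arcs\<close>

lemma graph_deg_eq: "real (graph_deg G v) = deg v"
proof -
  have "out_arcs (with_proj G) v = Pair v ` (parcs G `` {v})"
    by (auto simp: out_arcs_def)
  then show ?thesis by (simp add: graph_deg_def out_degree_def deg_def card_image inj_on_def)
qed

lemma inner_eq: "inner S = 2 * real (edges_within G S)"
proof -
  define A where "A = parcs G \<inter> S \<times> S"
  define \<phi> where "\<phi> e = {fst e, snd e}" for e :: "'a \<times> 'a"
  have img: "{e \<in> graph_edges G. e \<subseteq> S} = \<phi> ` A"
    by (force simp: graph_edges_def A_def \<phi>_def)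
  have fib: "card {a \<in> A. \<phi> a = e} = 2" if e: "e \<in> \<phi> ` A" for e
  proof -
    obtain x y where xy: "(x, y) \<in> A" "e = {x, y}" using e by (auto simp: \<phi>_def)
    have "{a \<in> A. \<phi> a = e} = {(x, y), (y, x)}"
      using xy arcs_symmetric by (auto simp: A_def \<phi>_def doubleton_eq_iff)
    moreover have "x \<noteq> y" using xy(1) by (auto simp: A_def dest: no_loops')
    ultimately show ?thesis by simp
  qed
  have "card A = (\<Sum>a\<in>A. 1)" by simp
  also have "\<dots> = (\<Sum>e\<in>\<phi> ` A. \<Sum>a\<in>{a \<in> A. \<phi> a = e}. 1)"
    using finite_E_Int by (intro sum.image_gen) (simp add: A_def)
  also have "\<dots> = (\<Sum>e\<in>\<phi> ` A. 2)" using fib by (intro sum.cong) auto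
  finally show ?thesis by (simp add: inner_def edges_within_def img A_def)
qed

lemma cut_eq: "cut S = real (card (edge_boundary G S))"
proof -
  have "bij_betw (\<lambda>(x, y). {x, y}) (parcs G \<inter> S \<times> - S) (edge_boundary G S)"
    unfolding bij_betw_def
  proof
    show "inj_on (\<lambda>(x, y). {x, y}) (parcs G \<inter> S \<times> - S)"
      by (auto simp: inj_on_def doubleton_eq_iff)
    show "(\<lambda>(x, y). {x, y}) ` (parcs G \<inter> S \<times> - S) = edge_boundary G S"
    proof (intro equalityI subsetI)
      fix e assume "e \<in> (\<lambda>(x, y). {x, y}) ` (parcs G \<inter> S \<times> - S)"
      then obtain x y where xy: "e = {x, y}" "(x, y) \<in> parcs G" "x \<in> S" "y \<notin> S" by auto
      then have "e \<inter> S = {x}" by auto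
      then show "e \<in> edge_boundary G S" using xy by (auto simp: edge_boundary_def graph_edges_def)
    next
      fix e assume "e \<in> edge_boundary G S"
      then obtain x y where xy: "e = {x, y}" "(x, y) \<in> parcs G" "card (e \<inter> S) = 1"
        by (auto simp: edge_boundary_def graph_edges_def)
      have ne: "x \<noteq> y" using xy(2) by (auto dest: no_loops')
      have "\<not> (x \<in> S \<and> y \<in> S)"
      proof
        assume "x \<in> S \<and> y \<in> S"
        then have "e \<inter> S = {x, y}" using xy by auto
        then show False using xy(3) ne by simp
      qed
      moreover have "x \<in> S \<or> y \<in> S"
      proof (rule ccontr)
        assume "\<not> (x \<in> S \<or> y \<in> S)"
        then have "e \<inter> S = {}" using xy by auto
        then show False using xy(3) by simp
      qed
      ultimately consider "x \<in> S" "y \<notin> S" | "y \<in> S" "x \<notin> S" by auto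
      then show "e \<in> (\<lambda>(x, y). {x, y}) ` (parcs G \<inter> S \<times> - S)"
      proof cases
        case 1 then show ?thesis using xy by (intro image_eqI[of _ _ "(x, y)"]) auto
      next
        case 2 then show ?thesis using xy arcs_symmetric by (intro image_eqI[of _ _ "(y, x)"]) auto
      qed
    qed
  qed
  then show ?thesis by (simp add: cut_def bij_betw_same_card)
qed

lemma vol_V_eq: "vol (pverts G) = 2 * real (card (graph_edges G))"
proof -
  have "{e \<in> graph_edges G. e \<subseteq> pverts G} = graph_edges G"
    using in_arcsD1 in_arcsD2 by (auto simp: graph_edges_def)
  then show ?thesis by (simp add: vol_V_eq_inner inner_eq edges_within_def)
qed

section \<open>Matrix powers and total variation distance\<close>

lemma sum_lazy_walk:
  assumes "x \<in> pverts G"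
  shows "(\<Sum>y\<in>pverts G. lazy_walk G x y * f y) = P f x"
proof -
  let ?N = "parcs G `` {x}"
  have "(\<Sum>y\<in>pverts G. lazy_walk G x y * f y)
      = (\<Sum>y\<in>pverts G. (if y = x then f x / 2 else 0) + (if y \<in> ?N then f y / (2 * deg x) else 0))"
  proof (rule sum.cong)
    fix y assume "y \<in> pverts G"
    show "lazy_walk G x y * f y = (if y = x then f x / 2 else 0) + (if y \<in> ?N then f y / (2 * deg x) else 0)"
      using no_loops'[of x y] by (auto simp: lazy_walk_def graph_deg_eq)
  qed simp
  also have "\<dots> = f x / 2 + (\<Sum>y\<in>pverts G. if y \<in> ?N then f y / (2 * deg x) else 0)"
    using assms pair_finite_verts by (simp add: sum.distrib)
  also have "(\<Sum>y\<in>pverts G. if y \<in> ?N then f y / (2 * deg x) else 0) = (\<Sum>y\<in>?N. f y / (2 * deg x))"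
    using pair_finite_verts in_arcsD2 by (intro sum.mono_neutral_cong_right) auto
  also have "f x / 2 + \<dots> = P f x"
    by (simp add: P_def sum_divide_distrib[symmetric] field_simps)
  finally show ?thesis .
qed

lemma sum_lazy_walk_pow:
  assumes "u \<in> pverts G"
  shows "(\<Sum>v\<in>pverts G. lazy_walk_pow G t u v * f v) = (P ^^ t) f u"
proof (induction t arbitrary: f)
  case 0
  have "(\<Sum>v\<in>pverts G. lazy_walk_pow G 0 u v * f v) = (\<Sum>v\<in>pverts G. if v = u then f v else 0)"
    by (intro sum.cong) auto
  then show ?case using assms pair_finite_verts by simp
next
  case (Suc t)
  have "(\<Sum>v\<in>pverts G. lazy_walk_pow G (Suc t) u v * f v)
      = (\<Sum>v\<in>pverts G. \<Sum>k\<in>pverts G. lazy_walk_pow G t u k * (lazy_walk G k v * f v))"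
    by (simp add: sum_distrib_right mult.assoc)
  also have "\<dots> = (\<Sum>k\<in>pverts G. \<Sum>v\<in>pverts G. lazy_walk_pow G t u k * (lazy_walk G k v * f v))"
    by (rule sum.swap)
  also have "\<dots> = (\<Sum>k\<in>pverts G. lazy_walk_pow G t u k * P f k)"
    by (simp add: sum_distrib_left[symmetric] sum_lazy_walk)
  also have "\<dots> = (P ^^ Suc t) f u" unfolding Suc funpow_Suc_right comp_apply ..
  finally show ?case .
qed

lemma walk_distr_point_mass:
  assumes "u \<in> pverts G"
  shows "walk_distr G (point_mass u) t v = lazy_walk_pow G t u v"
proof -
  have "walk_distr G (point_mass u) t v = (\<Sum>w\<in>pverts G. if w = u then lazy_walk_pow G t w v else 0)"
    unfolding walk_distr_def point_mass_def by (intro sum.cong) auto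
  then show ?thesis using assms pair_finite_verts by simp
qed

text \<open>Total variation distance is the difference of expectations of one test function, the
  indicator of the set where the walk has more mass than the stationary distribution.\<close>

lemma tv_dist_le:
  assumes u: "u \<in> pverts G"
    and le: "\<And>f. (\<And>y. y \<in> pverts G \<Longrightarrow> 0 \<le> f y) \<Longrightarrow> (\<And>y. y \<in> pverts G \<Longrightarrow> f y \<le> 1) \<Longrightarrow>
           (P ^^ t) f u - ip (\<lambda>_. 1) f / vol (pverts G) \<le> d"
  shows "tv_dist (pverts G) (walk_distr G (point_mass u) t) (stationary G) \<le> d"
proof -
  define V where "V = pverts G"
  define \<mu> where "\<mu> = lazy_walk_pow G t u"
  define \<nu> where "\<nu> = stationary G"
  define f where "f v = (if \<nu> v < \<mu> v then 1 else 0 :: real)" for v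
  have \<mu>: "(\<Sum>v\<in>V. \<mu> v * h v) = (P ^^ t) h u" for h
    unfolding \<mu>_def V_def by (rule sum_lazy_walk_pow[OF u])
  have \<nu>: "(\<Sum>v\<in>V. \<nu> v * h v) = ip (\<lambda>_. 1) h / vol V" for h
    unfolding \<nu>_def V_def stationary_def graph_deg_eq vol_V_eq ip_def by (simp add: sum_divide_distrib)
  have "ip (\<lambda>_. 1) (\<lambda>_. 1) = vol V" by (simp add: ip_def vol_def V_def)
  then have tot: "(\<Sum>v\<in>V. \<mu> v) = (\<Sum>v\<in>V. \<nu> v)"
    using \<mu>[of "\<lambda>_. 1"] \<nu>[of "\<lambda>_. 1"] vol_V_pos Pn_const[OF u] by (simp add: V_def)
  have "(\<Sum>v\<in>V. \<bar>\<mu> v - \<nu> v\<bar>) = (\<Sum>v\<in>V. 2 * (\<mu> v * f v - \<nu> v * f v) - (\<mu> v - \<nu> v))"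
    by (intro sum.cong) (auto simp: f_def)
  also have "\<dots> = 2 * ((\<Sum>v\<in>V. \<mu> v * f v) - (\<Sum>v\<in>V. \<nu> v * f v)) - ((\<Sum>v\<in>V. \<mu> v) - (\<Sum>v\<in>V. \<nu> v))"
    by (simp only: sum_subtractf sum_distrib_left[symmetric])
  also have "\<dots> = 2 * ((P ^^ t) f u - ip (\<lambda>_. 1) f / vol V)" using tot \<mu> \<nu> by simp
  also have "\<dots> \<le> 2 * d"
  proof -
    have "(P ^^ t) f u - ip (\<lambda>_. 1) f / vol (pverts G) \<le> d" by (rule le) (auto simp: f_def)
    then show ?thesis by (simp add: V_def)
  qed
  finally show ?thesis
    by (simp add: tv_dist_def walk_distr_point_mass[OF u] V_def \<mu>_def \<nu>_def)
qed

end

section \<open>Spreader graphs\<close>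

text \<open>A Cauchy tail of a series dominated by inverse squares. The factor
  \<open>4 * k\<^sup>2\<close> combines two counting bounds with volume at most
  \<open>2 * k\<^sup>2\<close> per set, see \<open>vol_bottlenecks\<close>.\<close>

lemma exp_sqrt_tail:
  assumes "0 < \<eta>"
  obtains M :: real where
    "\<And>x n. M \<le> x \<Longrightarrow> (\<Sum>k | x \<le> real k \<and> k \<le> n. 4 * (real k)\<^sup>2 * exp (- sqrt (real k))) \<le> \<eta>"
proof -
  let ?f = "\<lambda>k. 4 * (real k)\<^sup>2 * exp (- sqrt (real k))"
  have "eventually (\<lambda>k. ?f k \<le> inverse (real k ^ 2)) at_top"
    by real_asymp
  then have "eventually (\<lambda>k. norm (?f k) \<le> inverse (real k ^ 2)) at_top"
    by eventually_elim simp
  then have "summable ?f"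
    by (rule summable_comparison_test_ev) (rule inverse_power_summable, simp)
  then obtain N where N: "\<And>m n. m \<ge> N \<Longrightarrow> norm (sum ?f {m..<n}) < \<eta>"
    using assms unfolding summable_Cauchy by blast
  show thesis
  proof (rule that)
    fix x :: real and n :: nat assume x: "real N \<le> x"
    have "{k. x \<le> real k \<and> k \<le> n} = {nat \<lceil>x\<rceil>..<Suc n}"
      by (auto simp: nat_le_iff ceiling_le_iff)
    moreover have "N \<le> nat \<lceil>x\<rceil>" using x by linarith
    ultimately show "(\<Sum>k | x \<le> real k \<and> k \<le> n. ?f k) \<le> \<eta>" using N[of "nat \<lceil>x\<rceil>" "Suc n"] by simp
  qed
qed

lemma (in finite_sym_graph) vol_Union_le:
  assumes "finite F" and "\<And>S. S \<in> F \<Longrightarrow> S \<subseteq> V"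
  shows "vol (\<Union>F) \<le> (\<Sum>S\<in>F. vol S)"
  using assms
proof (induction F)
  case empty
  then show ?case by (simp add: vol_def)
next
  case (insert S F)
  have "vol (\<Union>(insert S F)) = vol (S \<union> (\<Union>F - S))" by simp
  also have "\<dots> = vol S + vol (\<Union>F - S)" using insert.prems by (intro vol_disjoint) auto
  also have "vol (\<Union>F - S) \<le> vol (\<Union>F)" using insert.prems by (intro vol_mono) auto
  finally show ?case using insert by simp
qed

context connected_pair_graph begin

definition size_threshold :: real where
  "size_threshold = ln (real (card (pverts G))) powr (1 / 5)"

text \<open>The size window is that of (S1) and (S2), so that both counts apply.\<close>

definition bottlenecks :: "real \<Rightarrow> real \<Rightarrow> 'a set set" where
  "bottlenecks c D = {S. S \<subseteq> pverts G \<and> size_threshold \<le> real (card S) \<and>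
     real (card S) \<le> (1 - 1 / D\<^sup>2) * real (card (pverts G)) \<and> connected_in G S \<and> cut S < c * vol S}"

text \<open>If neither held, \<open>inner S\<close> would be at most
  \<open>2 * card S / \<alpha>\<close>, hence at most \<open>2 / \<alpha>\<^sup>2\<close> times the
  cut; adding the cut itself gives the constant.\<close>

lemma bottleneck_thin_or_loaded:
  assumes "0 < \<alpha>" and "S \<in> bottlenecks (1 / (2 / \<alpha>\<^sup>2 + 1)) D"
  shows "thin \<alpha> G S \<or> loaded (1 / \<alpha>) G S"
proof (rule ccontr)
  assume "\<not> ?thesis"
  then have thin: "\<alpha> * real (card S) \<le> cut S" and load: "inner S \<le> 2 * (real (card S) / \<alpha>)"
    by (auto simp: thin_def loaded_def cut_eq inner_eq not_less)
  have S: "S \<subseteq> pverts G" "cut S < 1 / (2 / \<alpha>\<^sup>2 + 1) * vol S" using assms(2) by (auto simp: bottlenecks_def)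
  have "real (card S) \<le> cut S / \<alpha>" using thin assms(1) by (simp add: pos_le_divide_eq mult.commute)
  then have "real (card S) / \<alpha> \<le> cut S / \<alpha> / \<alpha>" using assms(1) by (intro divide_right_mono) auto
  then have "inner S \<le> 2 / \<alpha>\<^sup>2 * cut S" using load by (simp add: power2_eq_square)
  then have "vol S \<le> (2 / \<alpha>\<^sup>2 + 1) * cut S" using vol_split[OF S(1)] by (simp add: algebra_simps)
  moreover have "0 < 2 / \<alpha>\<^sup>2 + 1" using assms(1) by (simp add: add_pos_pos)
  ultimately have "1 / (2 / \<alpha>\<^sup>2 + 1) * vol S \<le> cut S" by (simp add: divide_le_eq mult.commute)
  then show False using S(2) by linarith
qed

text \<open>Union bound by size. The cut of a bottleneck is at most half its volume, so its volume
  is at most twice its inner arcs, hence at most \<open>2 * k\<^sup>2\<close> for size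
  \<open>k\<close>.\<close>

lemma vol_bottlenecks:
  assumes sp: "spreader \<alpha> D G" and \<alpha>: "0 < \<alpha>" "\<alpha> \<le> 1"
  shows "vol (\<Union>(bottlenecks (1 / (2 / \<alpha>\<^sup>2 + 1)) D)) \<le> real (card (pverts G)) *
    (\<Sum>k | size_threshold \<le> real k \<and> k \<le> card (pverts G). 4 * (real k)\<^sup>2 * exp (- sqrt (real k)))"
proof -
  define n where "n = real (card (pverts G))"
  define F where "F = bottlenecks (1 / (2 / \<alpha>\<^sup>2 + 1)) D"
  define K where "K = {k. size_threshold \<le> real k \<and> k \<le> card (pverts G)}"
  have FV: "S \<subseteq> pverts G" if "S \<in> F" for S using that by (auto simp: F_def bottlenecks_def)
  have finF: "finite F"
    using FV finite_V by (intro finite_subset[of F "Pow (pverts G)"]) auto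
  have finK: "finite K" unfolding K_def by simp
  have volS: "vol S \<le> 2 * (real (card S))\<^sup>2" if "S \<in> F" for S
  proof -
    have "1 / (2 / \<alpha>\<^sup>2 + 1) \<le> 1 / 2"
    proof -
      have "\<alpha>\<^sup>2 \<le> 1" using \<alpha> by (simp add: power_le_one)
      then have "1 \<le> 2 / \<alpha>\<^sup>2" using \<alpha> by (simp add: le_divide_eq)
      then show ?thesis by (intro divide_left_mono) auto
    qed
    then have "1 / (2 / \<alpha>\<^sup>2 + 1) * vol S \<le> 1 / 2 * vol S" by (intro mult_right_mono vol_nonneg)
    moreover have "cut S < 1 / (2 / \<alpha>\<^sup>2 + 1) * vol S" using that by (auto simp: F_def bottlenecks_def)
    ultimately have "cut S \<le> vol S / 2" by linarith
    then show ?thesis using vol_split[OF FV[OF that]] inner_le_square[OF FV[OF that]] by linarith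
  qed
  have count: "real (card {S \<in> F. card S = k}) \<le> 2 * (n * exp (- sqrt (real k)))" for k
  proof (cases "size_threshold \<le> real k \<and> real k \<le> (1 - 1 / D\<^sup>2) * n")
    case True
    let ?T = "{S. S \<subseteq> pverts G \<and> card S = k \<and> connected_in G S \<and> thin \<alpha> G S}"
    let ?L = "{S. S \<subseteq> pverts G \<and> card S = k \<and> connected_in G S \<and> loaded (1 / \<alpha>) G S}"
    have "{S \<in> F. card S = k} \<subseteq> ?T \<union> ?L"
      using bottleneck_thin_or_loaded[OF \<alpha>(1)] unfolding F_def by (auto simp: bottlenecks_def)
    moreover have "finite (?T \<union> ?L)"
      by (rule finite_subset[of _ "Pow (pverts G)"]) (auto simp: finite_V)
    ultimately have "card {S \<in> F. card S = k} \<le> card (?T \<union> ?L)" by (intro card_mono)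
    also have "\<dots> \<le> card ?T + card ?L" by (rule card_Un_le)
    finally have "real (card {S \<in> F. card S = k}) \<le> real (card ?T) + real (card ?L)" by linarith
    moreover have "real (card ?T) < n * exp (- sqrt (real k))" "real (card ?L) < n * exp (- sqrt (real k))"
      using sp True unfolding spreader_def Let_def size_threshold_def n_def by blast+
    ultimately show ?thesis by linarith
  next
    case False
    then have "{S \<in> F. card S = k} = {}" by (auto simp: F_def bottlenecks_def n_def)
    then have "real (card {S \<in> F. card S = k}) = 0" by (simp only: card.empty of_nat_0)
    then show ?thesis by (simp add: n_def)
  qed
  have "vol (\<Union>F) \<le> (\<Sum>S\<in>F. vol S)" using finF FV by (rule vol_Union_le)
  also have "\<dots> \<le> (\<Sum>S\<in>F. 2 * (real (card S))\<^sup>2)" by (intro sum_mono volS)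
  also have "\<dots> = (\<Sum>k\<in>K. \<Sum>S\<in>{S \<in> F. card S = k}. 2 * (real (card S))\<^sup>2)"
  proof (rule sum.group[symmetric, OF finF finK])
    show "card ` F \<subseteq> K" using finite_V by (auto simp: F_def K_def bottlenecks_def intro: card_mono)
  qed
  also have "\<dots> = (\<Sum>k\<in>K. real (card {S \<in> F. card S = k}) * (2 * (real k)\<^sup>2))"
    by (intro sum.cong) auto
  also have "\<dots> \<le> (\<Sum>k\<in>K. 2 * (n * exp (- sqrt (real k))) * (2 * (real k)\<^sup>2))"
    by (intro sum_mono mult_right_mono count) auto
  also have "\<dots> = n * (\<Sum>k\<in>K. 4 * (real k)\<^sup>2 * exp (- sqrt (real k)))"
    by (simp add: sum_distrib_left algebra_simps)
  finally show ?thesis by (simp add: F_def n_def K_def)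
qed

lemma vol_V_le:
  assumes "spreader \<alpha> D G" and "\<alpha> \<le> 1"
  shows "vol (pverts G) \<le> 2 * D * real (card (pverts G))"
proof -
  have "\<alpha> * real (card (pverts G)) \<le> 1 * real (card (pverts G))"
    using assms(2) by (rule mult_right_mono) simp
  then have "\<not> loaded D G (pverts G)" using assms(1) by (auto simp: spreader_def Let_def)
  then show ?thesis by (simp add: loaded_def vol_V_eq_inner inner_eq)
qed

text \<open>Sets below the size window are covered by the second alternative, sets inside it by not
  being bottlenecks, and larger ones by (S3) applied near the complement, which contains
  \<open>A\<close>.\<close>

lemma cut_ge_outside_bottlenecks:
  assumes sp: "spreader \<alpha> D G" and D: "4 \<le> D" and \<alpha>: "0 < \<alpha>" "\<alpha> \<le> 1"
    and n: "n = real (card (pverts G))" "16 \<le> n" "\<alpha> * n \<le> n / D\<^sup>2 - 1"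
    and A: "A \<subseteq> pverts G" "2 / 5 * vol (pverts G) \<le> vol A"
    and S: "S \<subseteq> pverts G - A" "u \<in> S" "\<And>v. v \<in> S \<Longrightarrow> (u, v) \<in> (parcs G \<inter> S \<times> S)\<^sup>*"
    and c: "0 < c" "c \<le> 1 / 2" "c \<le> 1 / (8 * D)" "c \<le> c'" "S \<notin> bottlenecks c' D"
  shows "c * vol S \<le> cut S \<or> vol S \<le> 2 * size_threshold\<^sup>2"
proof -
  have SV: "S \<subseteq> pverts G" using S by auto
  consider "real (card S) < size_threshold" | "size_threshold \<le> real (card S)" "real (card S) \<le> (1 - 1 / D\<^sup>2) * n"
    | "(1 - 1 / D\<^sup>2) * n < real (card S)" by linarith
  then show ?thesis
  proof cases
    case 1
    have "inner S \<le> (real (card S))\<^sup>2" by (rule inner_le_square[OF SV])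
    also have "\<dots> \<le> size_threshold\<^sup>2" using 1 by (intro power_mono) auto
    finally have in_le: "inner S \<le> size_threshold\<^sup>2" .
    have "c * vol S \<le> 1 / 2 * vol S" using c vol_nonneg by (intro mult_right_mono) auto
    then show ?thesis using vol_split[OF SV] in_le by linarith
  next
    case 2
    have "connected_in G S" using SV S(2,3) by (rule connected_in_of_reachable)
    then have "c' * vol S \<le> cut S" using 2 c(5) SV by (auto simp: bottlenecks_def n)
    moreover have "c * vol S \<le> c' * vol S" using c(4) vol_nonneg by (intro mult_right_mono) auto
    ultimately show ?thesis by simp
  next
    case 3
    define V where "V = pverts G"
    \<comment> \<open>The complement may be too small for (S3), so it is padded to a set
      \<open>T\<close> of exactly \<open>j\<close> vertices; the -1 in the assumption on
      \<open>\<alpha> * n\<close> absorbs the rounding.\<close>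
    define j where "j = nat \<lfloor>n / D\<^sup>2\<rfloor>"
    have nD: "0 \<le> n / D\<^sup>2" using n by simp
    have j: "real j \<le> n / D\<^sup>2" "n / D\<^sup>2 - 1 < real j" unfolding j_def using nD by linarith+
    have cardA': "card (V - S) = card V - card S"
      using SV finite_V by (simp add: V_def card_Diff_subset finite_subset)
    have "card S \<le> card V" using SV finite_V by (simp add: V_def card_mono)
    then have "real (card (V - S)) = real (card V) - real (card S)" using cardA' by simp
    also have "real (card V) = n" by (simp add: n V_def)
    also have "n - real (card S) < n / D\<^sup>2" using 3 by (simp add: algebra_simps)
    finally have lt: "real (card (V - S)) < n / D\<^sup>2" .
    have "card (V - S) \<le> j" unfolding j_def using lt by (simp add: le_nat_floor)
    moreover have "j \<le> card V"
    proof -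
      have "n / D\<^sup>2 \<le> n / 1" using D n by (intro divide_left_mono) (auto simp: one_le_power)
      then have "real j \<le> real (card V)" using j n by (simp add: V_def)
      then show ?thesis by simp
    qed
    ultimately obtain T where T: "V - S \<subseteq> T" "T \<subseteq> V" "card T = j"
      using exists_subset_between[of "V - S" j V] finite_V by (auto simp: V_def)
    have "\<alpha> * n \<le> real (card T)" using T j n by simp
    then have "\<not> loaded D G T" using sp T(2) by (auto simp: spreader_def Let_def n V_def)
    then have "inner T \<le> 2 * (D * real j)" using T(3) by (simp add: loaded_def inner_eq)
    also have "D * real j \<le> D * (n / D\<^sup>2)" using j D by (intro mult_left_mono) auto
    also have "D * (n / D\<^sup>2) = n / D" using D by (simp add: power2_eq_square)
    also have "n / D \<le> n / 4" using D n by (intro divide_left_mono) auto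
    finally have inT: "inner T \<le> n / 2" by simp
    have "inner (V - S) \<le> n / 2" using inner_mono[OF T(1)] inT by simp
    moreover have "vol A \<le> vol (V - S)" using A S by (intro vol_mono) (auto simp: V_def)
    moreover have "vol (V - S) = inner (V - S) + cut S"
      using vol_split[of "V - S"] cut_compl[OF SV] by (auto simp: V_def)
    moreover have "2 * (n - 1) \<le> vol (pverts G)" using vol_V_ge n by simp
    \<comment> \<open>The complement has volume at least \<open>4 / 5 * (n - 1)\<close> but at most
      \<open>n / 2\<close> inner arcs; the excess is at least \<open>n / 4\<close> once
      \<open>n \<ge> 16\<close>.\<close>
    ultimately have "2 / 5 * (2 * (n - 1)) \<le> n / 2 + cut S" using A(2) by linarith
    then have cut: "n / 4 \<le> cut S" using n(2) by simp
    have "c * vol S \<le> 1 / (8 * D) * (2 * D * n)"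
      using c vol_mono[OF SV] vol_V_le[OF sp \<alpha>(2)] D vol_nonneg[of S] n
      by (intro mult_mono) auto
    also have "\<dots> = n / 4" using D by simp
    finally show ?thesis using cut by simp
  qed
qed

text \<open>The bound of \<open>survival_bound\<close> at
  \<open>p0 = 2 * size_threshold\<^sup>2\<close>.\<close>

definition potential_bound :: "real \<Rightarrow> real" where
  "potential_bound c = (4 / c + 2) / ln (1 + c / 2) * ln (vol (pverts G))
     + (8 * (2 * size_threshold\<^sup>2) + 4) * (2 * size_threshold\<^sup>2 + 1) + (4 / c + 2) + (4 * (2 * size_threshold\<^sup>2) + 2)"

text \<open>Starting points outside all bottlenecks have distance at most
  \<open>5 * \<delta>\<close> by \<open>Pn_near_mean\<close>. The others number at most
  \<open>\<delta> * n\<close> and cost at most 1 more each.\<close>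

lemma avg_mixing_time_le:
  assumes sp: "spreader \<alpha> D G" and D: "4 \<le> D" and \<alpha>: "0 < \<alpha>" "\<alpha> \<le> 1"
    and n: "n = real (card (pverts G))" "16 \<le> n" "\<alpha> * n \<le> n / D\<^sup>2 - 1"
    and c: "0 < c" "c \<le> 1 / 2" "c \<le> 1 / (8 * D)" "c \<le> c'"
    and vol_bad: "vol (\<Union>(bottlenecks c' D)) \<le> \<delta> * n"
    and \<delta>: "0 < \<delta>" and W: "potential_bound c \<le> (real W + 1) * \<delta>"
    and s: "10 * real W \<le> (2 * real s + 1) * \<delta>\<^sup>2"
  shows "avg_mixing_time G (6 * \<delta>) \<le> s + W"
proof -
  define V where "V = pverts G"
  define B where "B = \<Union>(bottlenecks c' D)"
  define H where "H = V - B"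
  have BV: "B \<subseteq> V" by (auto simp: B_def bottlenecks_def V_def)
  then have VH: "V - H = B" by (auto simp: H_def)
  have nV: "n \<le> vol V" using card_le_vol[of V] by (simp add: n V_def)
  have volH: "vol (V - H) \<le> \<delta> * vol V"
    unfolding VH B_def using vol_bad mult_left_mono[OF nV, of \<delta>] \<delta> by linarith
  have surv: "survival A W x \<le> \<delta>" if A: "A \<subseteq> V" "2 / 5 * vol V \<le> vol A" and x: "x \<in> H" for A x
  proof (cases "x \<in> A")
    case True
    then show ?thesis using \<delta> by (simp add: survival_outside)
  next
    case False
    have xV: "x \<in> pverts G - A" using x False by (auto simp: H_def V_def)
    have ne: "A \<inter> pverts G \<noteq> {}"
    proof
      assume "A \<inter> pverts G = {}"
      then have "A = {}" using A(1) by (auto simp: V_def)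
      then have "vol A = 0" by (simp add: vol_def)
      then show False using A(2) vol_V_pos by (simp add: V_def)
    qed
    have "(real W + 1) * survival A W x \<le> potential_bound c"
      unfolding potential_bound_def
    proof (rule survival_bound[OF xV ne c(1)])
      fix S assume S: "S \<subseteq> pverts G - A" "x \<in> S" "\<And>v. v \<in> S \<Longrightarrow> (x, v) \<in> (parcs G \<inter> S \<times> S)\<^sup>*"
      have "S \<notin> bottlenecks c' D" using S(2) x by (auto simp: H_def B_def)
      then show "c * vol S \<le> cut S \<or> vol S \<le> 2 * size_threshold\<^sup>2"
        using A S c by (intro cut_ge_outside_bottlenecks[OF sp D \<alpha> n]) (auto simp: V_def)
    qed simp
    then have "(real W + 1) * survival A W x \<le> (real W + 1) * \<delta>" using W by linarith
    then show ?thesis by (simp add: mult_le_cancel_left_pos)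
  qed
  have tv: "tv_dist V (walk_distr G (point_mass x) (s + W)) (stationary G) \<le> 5 * \<delta> + (if x \<in> B then 1 else 0)"
    if x: "x \<in> V" for x
    unfolding V_def
  proof (rule tv_dist_le)
    show "x \<in> pverts G" using x by (simp add: V_def)
    fix f :: "'a \<Rightarrow> real" assume f: "\<And>y. y \<in> pverts G \<Longrightarrow> 0 \<le> f y" "\<And>y. y \<in> pverts G \<Longrightarrow> f y \<le> 1"
    show "(P ^^ (s + W)) f x - ip (\<lambda>_. 1) f / vol (pverts G) \<le> 5 * \<delta> + (if x \<in> B then 1 else 0)"
    proof (cases "x \<in> B")
      case True
      have "(P ^^ (s + W)) f x \<le> 1" using Pn_mono[of f "\<lambda>_. 1" x "s + W"] f x by (simp add: Pn_const V_def)
      moreover have "0 \<le> ip (\<lambda>_. 1) f" unfolding ip_def using f by (intro sum_nonneg) (simp add: deg_nonneg)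
      then have "0 \<le> ip (\<lambda>_. 1) f / vol (pverts G)" using vol_nonneg by (rule divide_nonneg_nonneg)
      ultimately show ?thesis using True \<delta> by simp
    next
      case False
      then have "x \<in> H" using x by (simp add: H_def)
      have "\<bar>(P ^^ (s + W)) f x - ip (\<lambda>_. 1) f / vol (pverts G)\<bar> \<le> 5 * \<delta>"
      proof (rule Pn_near_mean[OF f \<delta> s])
        show "H \<subseteq> pverts G" by (auto simp: H_def V_def)
      qed (use volH surv \<open>x \<in> H\<close> in \<open>simp_all add: V_def\<close>)
      then show ?thesis using False by simp
    qed
  qed
  have "(\<Sum>x\<in>V. tv_dist V (walk_distr G (point_mass x) (s + W)) (stationary G))
      \<le> (\<Sum>x\<in>V. 5 * \<delta> + (if x \<in> B then 1 else 0))"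
    by (intro sum_mono tv)
  also have "\<dots> = 5 * \<delta> * n + real (card B)"
  proof -
    have "(\<Sum>x\<in>V. if x \<in> B then 1 else 0 :: real) = real (card B)"
      using BV finite_V by (simp add: sum.If_cases V_def Int_absorb1)
    then show ?thesis by (simp add: sum.distrib n V_def)
  qed
  also have "\<dots> \<le> 6 * \<delta> * n"
    using card_le_vol[of B] BV vol_bad by (simp add: B_def V_def algebra_simps)
  finally have "1 / n * (\<Sum>x\<in>V. tv_dist V (walk_distr G (point_mass x) (s + W)) (stationary G)) \<le> 6 * \<delta>"
    using n(2) by (simp add: field_simps)
  then show ?thesis
    unfolding avg_mixing_time_def by (intro Least_le) (simp add: n V_def)
qed

end

text \<open>The exponent 1/5 puts \<open>z\<close> below the square root of \<open>ln n\<close>, so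
  even the term quadratic in \<open>z\<close> is of order \<open>ln n\<close>.\<close>

lemma (in connected_pair_graph) potential_bound_le:
  assumes vol: "vol (pverts G) \<le> 2 * D * n" and D: "1 \<le> D" and n: "n = real (card (pverts G))"
    and ln: "1 \<le> ln n" and c: "0 < c"
  shows "potential_bound c \<le> ((4 / c + 2) / ln (1 + c / 2) * (ln (2 * D) + 1) + 60 + (4 / c + 2) + 10) * ln n"
proof -
  define K where "K = (4 / c + 2) / ln (1 + c / 2)"
  define y where "y = sqrt (ln n)"
  define z where "z = size_threshold\<^sup>2"
  have K: "0 \<le> K" using c by (simp add: K_def)
  have n0: "0 < n" using nontrivial by (simp add: n)
  have y: "1 \<le> y" "y * y = ln n" using ln by (simp_all add: y_def)
  have z: "0 \<le> z" "z \<le> y"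
  proof -
    have "z = ln n powr (2 / 5)"
      unfolding z_def size_threshold_def n[symmetric] power2_eq_square by (simp add: powr_add[symmetric])
    also have "\<dots> \<le> ln n powr (1 / 2)" using ln by (intro powr_mono) auto
    also have "\<dots> = y" using ln by (simp add: y_def powr_half_sqrt)
    finally show "z \<le> y" .
  qed (simp add: z_def)
  have "ln (vol (pverts G)) \<le> ln (2 * D * n)" using vol vol_V_pos by (intro ln_mono) auto
  also have "\<dots> = ln (2 * D) + ln n" using D n0 by (simp add: ln_mult)
  also have "\<dots> \<le> (ln (2 * D) + 1) * ln n"
  proof -
    have "0 \<le> ln (2 * D)" using D by simp
    then have "ln (2 * D) * 1 \<le> ln (2 * D) * ln n" using ln by (intro mult_left_mono) auto
    then show ?thesis by (simp add: distrib_right)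
  qed
  finally have 1: "K * ln (vol (pverts G)) \<le> K * ((ln (2 * D) + 1) * ln n)" using K by (rule mult_left_mono)
  have "(8 * (2 * z) + 4) * (2 * z + 1) \<le> (20 * y) * (3 * y)"
    using y z by (intro mult_mono) auto
  then have 2: "(8 * (2 * z) + 4) * (2 * z + 1) \<le> 60 * ln n" using y(2) by simp
  have 3: "4 / c + 2 \<le> (4 / c + 2) * ln n" using mult_left_mono[OF ln, of "4 / c + 2"] c by simp
  have "y * 1 \<le> y * y" using y by (intro mult_left_mono) auto
  then have 4: "4 * (2 * z) + 2 \<le> 10 * ln n" using z y ln by simp
  have "potential_bound c \<le> K * ((ln (2 * D) + 1) * ln n) + 60 * ln n + (4 / c + 2) * ln n + 10 * ln n"
    unfolding potential_bound_def z_def[symmetric] K_def[symmetric] by (intro add_mono 1 2 3 4)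
  also have "\<dots> = (K * (ln (2 * D) + 1) + 60 + (4 / c + 2) + 10) * ln n" by (simp only: distrib_right mult.assoc)
  finally show ?thesis by (simp only: K_def)
qed

theorem theorem1p5:
  fixes \<epsilon> D \<alpha> :: real
  assumes "\<epsilon> > 0" and "D \<ge> 4" and "0 < \<alpha>" and "\<alpha> < 1 / D\<^sup>2"
  shows "\<exists>C::real. C > 0 \<and> (\<exists>N::nat. \<forall>n\<ge>N. \<forall>G :: 'a pair_pre_digraph.
           pair_graph G \<and> card (pverts G) = n \<and> graph_connected G \<and> spreader \<alpha> D G \<longrightarrow>
           real (avg_mixing_time G \<epsilon>) \<le> C * ln (real n))"
proof -
  define \<delta> where "\<delta> = \<epsilon> / 6"
  define c' where "c' = 1 / (2 / \<alpha>\<^sup>2 + 1)"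
  define c where "c = min c' (1 / (8 * D))"
  define C1 where "C1 = (4 / c + 2) / ln (1 + c / 2) * (ln (2 * D) + 1) + 60 + (4 / c + 2) + 10"
  \<comment> \<open>With \<open>s = r * W\<close> this ensures
    \<open>10 * W \<le> 2 * s * \<delta>\<^sup>2\<close>, so the window is short compared to
    \<open>s\<close>. The total time is then \<open>(r + 1) * W\<close>.\<close>
  define r where "r = nat \<lceil>5 / \<delta>\<^sup>2\<rceil>"
  define C where "C = (C1 / \<delta> + 1) * (real r + 1)"
  have \<delta>: "0 < \<delta>" using assms(1) by (simp add: \<delta>_def)
  have \<alpha>1: "\<alpha> \<le> 1"
  proof -
    have "1 / D\<^sup>2 \<le> 1" using assms(2) by (simp add: one_le_power)
    then show ?thesis using assms(4) by simp
  qed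
  have c'0: "0 < c'" using assms(3) by (simp add: c'_def add_pos_pos)
  have c: "0 < c" "c \<le> 1 / 2" "c \<le> 1 / (8 * D)" "c \<le> c'"
  proof -
    show "0 < c" using c'0 assms(2) by (simp add: c_def)
    show 8: "c \<le> 1 / (8 * D)" and "c \<le> c'" by (simp_all add: c_def)
    have "1 / (8 * D) \<le> 1 / 2" using assms(2) by (intro divide_left_mono) auto
    then show "c \<le> 1 / 2" using 8 by linarith
  qed
  have C1: "0 < C1"
  proof -
    have "0 \<le> (4 / c + 2) / ln (1 + c / 2) * (ln (2 * D) + 1)" using c(1) assms(2) by simp
    moreover have "0 < 4 / c" using c(1) by simp
    ultimately show ?thesis unfolding C1_def by linarith
  qed
  have r: "5 \<le> real r * \<delta>\<^sup>2"
  proof -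
    have "5 / \<delta>\<^sup>2 \<le> real r" unfolding r_def by linarith
    then show ?thesis using \<delta> by (simp add: divide_le_eq)
  qed
  have Cpos: "0 < C" using C1 \<delta> by (simp add: C_def add_pos_nonneg)
  obtain M :: real where M: "\<And>x n. M \<le> x \<Longrightarrow> (\<Sum>k | x \<le> real k \<and> k \<le> n. 4 * (real k)\<^sup>2 * exp (- sqrt (real k))) \<le> \<delta>"
    using exp_sqrt_tail[OF \<delta>] by blast
  have "filterlim (\<lambda>n. ln (real n) powr (1 / 5)) at_top at_top" by real_asymp
  then have "eventually (\<lambda>n. M \<le> ln (real n) powr (1 / 5)) at_top" by (auto simp: filterlim_at_top)
  moreover have "eventually (\<lambda>n. 1 \<le> ln (real n)) at_top" by real_asymp
  moreover have "eventually (\<lambda>n. 16 \<le> n) (at_top :: nat filter)" by (rule eventually_ge_at_top)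
  \<comment> \<open>The strict gap between \<alpha> and \<open>1 / D\<^sup>2\<close> gives
    \<open>\<alpha> * n \<le> n / D\<^sup>2 - 1\<close> for these \<open>n\<close>.\<close>
  moreover have "eventually (\<lambda>n. nat \<lceil>1 / (1 / D\<^sup>2 - \<alpha>)\<rceil> \<le> n) (at_top :: nat filter)" by (rule eventually_ge_at_top)
  ultimately have "eventually (\<lambda>n. M \<le> ln (real n) powr (1 / 5) \<and> 1 \<le> ln (real n) \<and> 16 \<le> n \<and>
      nat \<lceil>1 / (1 / D\<^sup>2 - \<alpha>)\<rceil> \<le> n) at_top"
    by (intro eventually_conj)
  then obtain N where N: "\<And>n. N \<le> n \<Longrightarrow> M \<le> ln (real n) powr (1 / 5) \<and> 1 \<le> ln (real n) \<and> 16 \<le> n \<and>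
      nat \<lceil>1 / (1 / D\<^sup>2 - \<alpha>)\<rceil> \<le> n"
    unfolding eventually_at_top_linorder by blast
  have "real (avg_mixing_time G \<epsilon>) \<le> C * ln (real n)"
    if n: "N \<le> n" and G: "pair_graph G" "card (pverts G) = n" "graph_connected G" "spreader \<alpha> D G"
    for n and G :: "'a pair_pre_digraph"
  proof -
    note large = N[OF n]
    interpret pair_graph G by (rule G(1))
    interpret connected_pair_graph G
      by unfold_locales (use G large in auto)
    have n': "real n = real (card (pverts G))" by (simp add: G(2))
    have \<alpha>n: "\<alpha> * real n \<le> real n / D\<^sup>2 - 1"
    proof -
      have "1 / (1 / D\<^sup>2 - \<alpha>) \<le> real n" using large by linarith
      then have "1 \<le> real n * (1 / D\<^sup>2 - \<alpha>)" using assms(4) by (simp add: divide_le_eq)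
      then show ?thesis by (simp add: algebra_simps)
    qed
    define W where "W = nat \<lceil>C1 * ln (real n) / \<delta>\<rceil>"
    define s where "s = r * W"
    have "C1 * ln (real n) / \<delta> \<le> real W + 1" unfolding W_def by linarith
    then have "C1 * ln (real n) \<le> (real W + 1) * \<delta>" using \<delta> by (simp add: divide_le_eq)
    moreover have "potential_bound c \<le> C1 * ln (real n)"
      unfolding C1_def using vol_V_le[OF G(4) \<alpha>1] n' large c(1) assms(2) by (intro potential_bound_le) auto
    ultimately have W: "potential_bound c \<le> (real W + 1) * \<delta>" by linarith
    have s: "10 * real W \<le> (2 * real s + 1) * \<delta>\<^sup>2"
    proof -
      have "10 * real W \<le> 2 * real W * (real r * \<delta>\<^sup>2)"
        using mult_left_mono[OF r, of "2 * real W"] by simp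
      also have "\<dots> \<le> (2 * real s + 1) * \<delta>\<^sup>2" by (simp add: s_def algebra_simps)
      finally show ?thesis .
    qed
    have "vol (\<Union>(bottlenecks c' D)) \<le> real (card (pverts G)) *
        (\<Sum>k | size_threshold \<le> real k \<and> k \<le> card (pverts G). 4 * (real k)\<^sup>2 * exp (- sqrt (real k)))"
      unfolding c'_def by (rule vol_bottlenecks[OF G(4) assms(3) \<alpha>1])
    also have "\<dots> \<le> real (card (pverts G)) * \<delta>"
      using large by (intro mult_left_mono M) (auto simp: size_threshold_def G(2))
    finally have bad: "vol (\<Union>(bottlenecks c' D)) \<le> \<delta> * real n" by (simp add: G(2) mult.commute)
    have n16: "16 \<le> real n" using large by simp
    have "avg_mixing_time G (6 * \<delta>) \<le> s + W"
      using avg_mixing_time_le[OF G(4) assms(2,3) \<alpha>1 n' n16 \<alpha>n c bad \<delta> W s] .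
    then have "real (avg_mixing_time G \<epsilon>) \<le> real W * (real r + 1)"
      unfolding \<delta>_def s_def by (simp add: algebra_simps flip: of_nat_mult of_nat_add of_nat_Suc)
    also have "real W \<le> (C1 / \<delta> + 1) * ln (real n)"
    proof -
      have "0 \<le> C1 * ln (real n) / \<delta>" using C1 \<delta> large by simp
      then have "real W \<le> C1 * ln (real n) / \<delta> + 1" unfolding W_def by linarith
      also have "\<dots> \<le> C1 * ln (real n) / \<delta> + ln (real n)" using large by simp
      finally show ?thesis by (simp add: algebra_simps)
    qed
    then have "real W * (real r + 1) \<le> C * ln (real n)"
      using mult_right_mono[of "real W" "(C1 / \<delta> + 1) * ln (real n)" "real r + 1"]
      by (simp add: C_def mult_ac)
    finally show ?thesis .
  qed
  then show ?thesis using Cpos by blast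
qed

end
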